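(* Let $n, k$ be integers such that $10^{36} \le k \le 0.9 \cdot n$. Then there exists a subset $S \subseteq [n]^2$ that contains exactly $k$ points on each horizontal line $\{(x,y)\in\mathbb{R}^2 : y = j\}$, $j \in [n]$, and exactly $k$ points on each vertical line $\{(x,y)\in\mathbb{R}^2 : x = i\}$, $i \in [n]$, and such that $|S \cap L| \le k\cdot(w(L) + 0.01)$ for every other line $L \in \mathcal{L}$ (i.e. every $L \in \mathcal{L}$ that is neither horizontal nor vertical).
   Context: $[n] = \{1, \ldots, n\}$. $\mathcal{L}$ denotes the set of lines in $\mathbb{R}^2$ intersecting the grid $[n]^2$ in at least two points. For $L \in \mathcal{L}$, its weight is $w(L) := |[n]^2 \cap L|/n$. *)

theory Defs
  imports "HOL-Analysis.Analysis"
begin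

definition grid :: "nat \<Rightarrow> (real \<times> real) set" where
  "grid n = (real ` {1..n}) \<times> (real ` {1..n})"

definition grid_lines :: "nat \<Rightarrow> (real \<times> real) set set" where
  "grid_lines n = {L. affine L \<and> aff_dim L = 1 \<and> card (grid n \<inter> L) \<ge> 2}"

definition weight :: "nat \<Rightarrow> (real \<times> real) set \<Rightarrow> real" where
  "weight n L = real (card (grid n \<inter> L)) / real n"

definition horizontal_line :: "real \<Rightarrow> (real \<times> real) set" where
  "horizontal_line c = {(x, y). y = c}"

definition vertical_line :: "real \<Rightarrow> (real \<times> real) set" where
  "vertical_line c = {(x, y). x = c}"

end

theory Submission
  imports Defs
begin

text \<open>
  Let \<open>S\<close> consist of the \<open>(x, y)\<close> with \<open>R x (\<phi> y)\<close>, where \<open>\<phi>\<close> is a bijection from rows to columns and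
  \<open>R\<close> is a \<open>k\<close>-regular relation on columns. Then \<open>S\<close> is \<open>k\<close>-regular whatever \<open>\<phi>\<close> is, and only upper
  bounds on the oblique lines remain. The bijection is revealed in stages. At a stage with parameter
  \<open>m\<close> the columns and the rows are cut into matched classes of size \<open>m\<close> or \<open>m + 1\<close>, and one keeps the
  points whose column and row belong to matched classes, so that every row and column keeps about \<open>m\<close>
  points. A line of weight \<open>w \<ge> 1 / m\<^sup>2\<close> is required to keep at most \<open>m w + m powr (2/3)\<close> points and a
  lighter one at most \<open>k / 1000\<close>.

  To pass from \<open>m\<close> to \<open>m powr (1/4)\<close>, match the rows and columns inside each class by independent
  uniform bijections and refine the column classes. A given line violates its new bound with
  probability smaller than any fixed power of \<open>1 / m\<close>, while it interacts with only polynomially many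
  (in \<open>m\<close>) lines of weight at least \<open>1 / m\<^sup>2\<close>, so the local lemma applies. Lighter lines need no
  attention, since their points are only ever removed. The last stage uses a \<open>k\<close>-regular
  relation inside each class instead of a refinement.
\<close>

section \<open>A local lemma for product spaces\<close>

text \<open>
  Counting proof in the style of Rosenfeld: adding one coordinate \<open>v\<close> multiplies the number of partial
  assignments avoiding the bad events by at least \<open>\<beta> * card (\<Omega> v)\<close>.
\<close>

lemma local_lemma_product:
  fixes \<Omega> :: "'i \<Rightarrow> 'a set" and V :: "'k \<Rightarrow> 'i set" and Bad :: "'k \<Rightarrow> ('i \<Rightarrow> 'a) \<Rightarrow> bool"
    and p :: "'k \<Rightarrow> real" and \<beta> :: real
  assumes "finite I" "finite K"
    and \<Omega>: "\<And>i. i \<in> I \<Longrightarrow> finite (\<Omega> i) \<and> \<Omega> i \<noteq> {}"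
    and V: "\<And>k. k \<in> K \<Longrightarrow> V k \<subseteq> I \<and> V k \<noteq> {}"
    and loc: "\<And>k f g. k \<in> K \<Longrightarrow> (\<And>i. i \<in> V k \<Longrightarrow> f i = g i) \<Longrightarrow> Bad k f = Bad k g"
    and prob: "\<And>k. k \<in> K \<Longrightarrow>
      real (card {f \<in> PiE (V k) \<Omega>. Bad k f}) \<le> p k * (\<Prod>i\<in>V k. real (card (\<Omega> i)))"
    and \<beta>: "0 < \<beta>"
    and sum: "\<And>v. v \<in> I \<Longrightarrow> (\<Sum>k | k \<in> K \<and> v \<in> V k. p k / \<beta> ^ (card (V k) - 1)) \<le> 1 - \<beta>"
  shows "\<exists>f \<in> PiE I \<Omega>. \<forall>k\<in>K. \<not> Bad k f"
proof -
  \<comment> \<open>The good partial assignments on \<open>S\<close>: only events whose whole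
    coordinate set lies in \<open>S\<close> are tested.\<close>
  define G where "G S = {f \<in> PiE S \<Omega>. \<forall>k\<in>K. V k \<subseteq> S \<longrightarrow> \<not> Bad k f}" for S
  have finS: "finite S" if "S \<subseteq> I" for S using that \<open>finite I\<close> finite_subset by blast
  have finPi: "finite (PiE S \<Omega>)" if "S \<subseteq> I" for S
    using that \<Omega> finS by (intro finite_PiE) auto
  have finG: "finite (G S)" if "S \<subseteq> I" for S
    using finPi[OF that] unfolding G_def by auto
  have cpos: "0 < real (card (\<Omega> i))" if "i \<in> I" for i
    using \<Omega>[OF that] by (simp add: card_gt_0_iff)
  have claim: "\<beta> * real (card (\<Omega> v)) * real (card (G S)) \<le> real (card (G (insert v S)))"
    if "S \<subseteq> I" "v \<in> I - S" for S v
    using finS[OF that(1)] that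
  proof (induction S arbitrary: v rule: finite_psubset_induct)
    case (psubset S)
    \<comment> \<open>The induction hypothesis for proper subsets of \<open>S\<close>, chained over
      \<open>U\<close>: giving back the coordinates of \<open>U\<close> one by one multiplies the
      number of good assignments by at least \<open>\<beta> * card (\<Omega> u)\<close> each
      time.\<close>
    have iter: "\<beta> ^ card U * (\<Prod>i\<in>U. real (card (\<Omega> i))) * real (card (G (S - U))) \<le> real (card (G S))"
      if "U \<subseteq> S" for U
    proof -
      have "finite U" using that psubset.prems(1) finS by blast
      then show ?thesis using that
      proof (induction U)
        case empty then show ?case by simp
      next
        case (insert u U)
        let ?S = "S - insert u U"
        have "\<beta> * real (card (\<Omega> u)) * real (card (G ?S)) \<le> real (card (G (insert u ?S)))"
          using insert.prems psubset.prems by (intro psubset.IH) auto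
        also have "insert u ?S = S - U" using insert by auto
        finally have s: "\<beta> * real (card (\<Omega> u)) * real (card (G ?S)) \<le> real (card (G (S - U)))" .
        have "\<beta> ^ card (insert u U) * (\<Prod>i\<in>insert u U. real (card (\<Omega> i))) * real (card (G ?S))
            = \<beta> ^ card U * (\<Prod>i\<in>U. real (card (\<Omega> i))) * (\<beta> * real (card (\<Omega> u)) * real (card (G ?S)))"
          using insert by simp
        also have "\<dots> \<le> \<beta> ^ card U * (\<Prod>i\<in>U. real (card (\<Omega> i))) * real (card (G (S - U)))"
          using s \<beta> by (intro mult_left_mono mult_nonneg_nonneg prod_nonneg) auto
        also have "\<dots> \<le> real (card (G S))" using insert by auto
        finally show ?case .
      qed
    qed
    \<comment> \<open>All extensions of good assignments on \<open>S\<close> by a value at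
      \<open>v\<close>. One that is not good satisfies a bad event involving \<open>v\<close>, since
      the other events in range are already decided on \<open>S\<close>.\<close>
    define E where "E = (\<lambda>(y, g). g(v := y)) ` (\<Omega> v \<times> G S)"
    have vS: "v \<notin> S" "v \<in> I" using psubset.prems by auto
    have GPi: "g \<in> PiE S \<Omega>" if "g \<in> G S" for g using that unfolding G_def by auto
    have "inj_on (\<lambda>(y, g). g(v := y)) (\<Omega> v \<times> G S)"
    proof (rule inj_onI, clarify)
      fix y g y' g' assume h: "g \<in> G S" "g' \<in> G S" "g(v := y) = g'(v := y')"
      have "y = y'" using fun_cong[OF h(3), of v] by simp
      moreover have "g = g'"
      proof
        fix x show "g x = g' x"
          using fun_cong[OF h(3), of x] GPi[OF h(1)] GPi[OF h(2)] vS(1)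
          by (cases "x = v") (auto simp: PiE_def extensional_def)
      qed
      ultimately show "y = y' \<and> g = g'" by simp
    qed
    then have cE: "card E = card (\<Omega> v) * card (G S)"
      unfolding E_def by (simp add: card_image card_cartesian_product)
    have finE: "finite E" unfolding E_def using finG \<Omega> vS psubset.prems by auto
    have EPi: "E \<subseteq> PiE (insert v S) \<Omega>"
      unfolding E_def PiE_insert_eq using GPi by force
    let ?K = "{k \<in> K. v \<in> V k}"
    let ?L = "{k \<in> ?K. V k \<subseteq> insert v S}"
    define B where "B k = {f \<in> E. Bad k f}" for k
    have sub: "E \<subseteq> G (insert v S) \<union> (\<Union>k\<in>?L. B k)"
    proof
      fix f assume f: "f \<in> E"
      then obtain y g where g: "g \<in> G S" "f = g(v := y)" unfolding E_def by auto
      show "f \<in> G (insert v S) \<union> (\<Union>k\<in>?L. B k)"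
      proof (cases "\<exists>k\<in>?L. Bad k f")
        case True then show ?thesis using f unfolding B_def by auto
      next
        case False
        have "\<not> Bad k f" if "k \<in> K" "V k \<subseteq> insert v S" for k
        proof (cases "v \<in> V k")
          case True then show ?thesis using False that by auto
        next
          case nv: False
          then have "V k \<subseteq> S" using that by auto
          moreover have "Bad k f = Bad k g" using nv g(2) that(1) by (intro loc) auto
          ultimately show ?thesis using g(1) that(1) unfolding G_def by auto
        qed
        then show ?thesis using EPi f unfolding G_def by auto
      qed
    qed
    \<comment> \<open>A bad extension is encoded by its restrictions to \<open>S - V k\<close> and
      \<open>V k\<close>. The first is good, the second is counted by \<open>prob\<close>, and
      \<open>iter\<close> with \<open>U = V k - {v}\<close> compares \<open>G (S - V k)\<close> with
      \<open>G S\<close>; hence the exponent \<open>card (V k) - 1\<close>.\<close>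
    have Bcard: "real (card (B k)) \<le> p k / \<beta> ^ (card (V k) - 1) * (real (card (\<Omega> v)) * real (card (G S)))"
      if k: "k \<in> ?L" for k
    proof -
      let ?A = "G (S - V k) \<times> {f \<in> PiE (V k) \<Omega>. Bad k f}"
      have kK: "k \<in> K" "v \<in> V k" "V k \<subseteq> insert v S" "V k \<subseteq> I" using k V by auto
      have "card (B k) \<le> card ?A"
      proof (rule card_inj_on_le[where f = "\<lambda>f. (restrict f (S - V k), restrict f (V k))"])
        show "inj_on (\<lambda>f. (restrict f (S - V k), restrict f (V k))) (B k)"
        proof (rule inj_onI)
          fix f g assume h: "f \<in> B k" "g \<in> B k"
            "(restrict f (S - V k), restrict f (V k)) = (restrict g (S - V k), restrict g (V k))"
          have fg: "f \<in> PiE (insert v S) \<Omega>" "g \<in> PiE (insert v S) \<Omega>" using h EPi unfolding B_def by auto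
          show "f = g"
          proof
            fix x
            have r: "restrict f (S - V k) x = restrict g (S - V k) x" "restrict f (V k) x = restrict g (V k) x"
              using h(3) by auto
            show "f x = g x"
              using r fg kK vS by (cases "x = v"; cases "x \<in> V k"; cases "x \<in> S") (auto simp: PiE_def extensional_def)
          qed
        qed
        show "(\<lambda>f. (restrict f (S - V k), restrict f (V k))) ` B k \<subseteq> ?A"
        proof (rule image_subsetI)
          fix f assume f: "f \<in> B k"
          then obtain y g where g: "g \<in> G S" "f = g(v := y)" unfolding B_def E_def by auto
          have fP: "f \<in> PiE (insert v S) \<Omega>" "Bad k f" using f EPi unfolding B_def by auto
          have b: "Bad k (restrict f (V k))" using fP(2) loc[OF kK(1), of f "restrict f (V k)"] by auto
          have "\<not> Bad l (restrict f (S - V k))" if "l \<in> K" "V l \<subseteq> S - V k" for l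
          proof -
            have "Bad l (restrict f (S - V k)) = Bad l g"
              using that g(2) kK vS by (intro loc) auto
            then show ?thesis using g(1) that unfolding G_def by auto
          qed
          moreover have "restrict f (S - V k) \<in> PiE (S - V k) \<Omega>" "restrict f (V k) \<in> PiE (V k) \<Omega>"
            using fP(1) kK by (auto simp: PiE_iff)
          ultimately show "(restrict f (S - V k), restrict f (V k)) \<in> ?A"
            using b unfolding G_def by auto
        qed
        show "finite ?A" using finG[of "S - V k"] finPi[OF kK(4)] psubset.prems(1) by (intro finite_cartesian_product) auto
      qed
      then have "real (card (B k)) \<le> real (card (G (S - V k))) * real (card {f \<in> PiE (V k) \<Omega>. Bad k f})"
        by (metis card_cartesian_product of_nat_le_iff of_nat_mult)
      also have "\<dots> \<le> real (card (G (S - V k))) * (p k * (\<Prod>i\<in>V k. real (card (\<Omega> i))))"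
        using prob[OF kK(1)] by (intro mult_left_mono) auto
      finally have 1: "real (card (B k)) \<le> real (card (G (S - V k))) * (p k * (\<Prod>i\<in>V k. real (card (\<Omega> i))))" .
      let ?U = "V k - {v}"
      have fV: "finite (V k)" using kK(4) finS by auto
      have US: "?U \<subseteq> S" "S - ?U = S - V k" using kK vS by auto
      have pr: "(\<Prod>i\<in>V k. real (card (\<Omega> i))) = real (card (\<Omega> v)) * (\<Prod>i\<in>?U. real (card (\<Omega> i)))"
        using fV kK(2) by (simp add: prod.remove)
      have prpos: "0 < (\<Prod>i\<in>V k. real (card (\<Omega> i)))" using kK(4) by (intro prod_pos cpos) auto
      have "0 \<le> p k * (\<Prod>i\<in>V k. real (card (\<Omega> i)))"
        using prob[OF kK(1)] by (meson of_nat_0_le_iff order_trans)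
      then have pk: "0 \<le> p k" using prpos by (simp add: zero_le_mult_iff)
      have it: "\<beta> ^ (card (V k) - 1) * (\<Prod>i\<in>?U. real (card (\<Omega> i))) * real (card (G (S - V k))) \<le> real (card (G S))"
        using iter[OF US(1)] US(2) fV kK(2) by simp
      have bp: "0 < \<beta> ^ (card (V k) - 1)" using \<beta> by simp
      have "p k * real (card (\<Omega> v)) * (\<beta> ^ (card (V k) - 1) * (\<Prod>i\<in>?U. real (card (\<Omega> i))) * real (card (G (S - V k))))
          \<le> p k * real (card (\<Omega> v)) * real (card (G S))"
        using it pk by (intro mult_left_mono) auto
      then have "real (card (G (S - V k))) * (p k * (\<Prod>i\<in>V k. real (card (\<Omega> i)))) * \<beta> ^ (card (V k) - 1)
          \<le> p k * real (card (\<Omega> v)) * real (card (G S))"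
        unfolding pr by (simp add: mult_ac)
      then have "real (card (G (S - V k))) * (p k * (\<Prod>i\<in>V k. real (card (\<Omega> i))))
          \<le> p k / \<beta> ^ (card (V k) - 1) * (real (card (\<Omega> v)) * real (card (G S)))"
        using bp by (simp add: pos_le_divide_eq mult_ac)
      with 1 show ?thesis by linarith
    qed
    let ?w = "real (card (\<Omega> v)) * real (card (G S))"
    have pnn: "0 \<le> p k" if "k \<in> K" for k
    proof -
      have "0 < (\<Prod>i\<in>V k. real (card (\<Omega> i)))" using V[OF that] by (intro prod_pos cpos) auto
      moreover have "0 \<le> p k * (\<Prod>i\<in>V k. real (card (\<Omega> i)))"
        using prob[OF that] by (meson of_nat_0_le_iff order_trans)
      ultimately show ?thesis by (simp add: zero_le_mult_iff)
    qed
    have finL: "finite ?L" using \<open>finite K\<close> by auto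
    have finBU: "finite (\<Union>k\<in>?L. B k)" using finE unfolding B_def by (rule finite_subset[rotated]) auto
    have "?w = real (card E)" using cE by simp
    also have "\<dots> \<le> real (card (G (insert v S) \<union> (\<Union>k\<in>?L. B k)))"
      using sub finBU finG[of "insert v S"] psubset.prems by (intro of_nat_mono card_mono) auto
    also have "\<dots> \<le> real (card (G (insert v S))) + real (card (\<Union>k\<in>?L. B k))"
      unfolding of_nat_add[symmetric] of_nat_le_iff by (rule card_Un_le)
    finally have c1: "?w \<le> real (card (G (insert v S))) + real (card (\<Union>k\<in>?L. B k))" .
    have "real (card (\<Union>k\<in>?L. B k)) \<le> (\<Sum>k\<in>?L. real (card (B k)))"
      unfolding of_nat_sum[symmetric] of_nat_le_iff by (rule card_UN_le[OF finL])
    also have "\<dots> \<le> (\<Sum>k\<in>?L. p k / \<beta> ^ (card (V k) - 1) * ?w)"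
      by (rule sum_mono) (rule Bcard)
    also have "\<dots> \<le> (\<Sum>k\<in>?K. p k / \<beta> ^ (card (V k) - 1) * ?w)"
      using \<open>finite K\<close> pnn \<beta> by (intro sum_mono2) auto
    also have "\<dots> = (\<Sum>k\<in>?K. p k / \<beta> ^ (card (V k) - 1)) * ?w" by (simp add: sum_distrib_right)
    also have "\<dots> \<le> (1 - \<beta>) * ?w" using sum[OF vS(2)] by (intro mult_right_mono) auto
    finally have "real (card (\<Union>k\<in>?L. B k)) \<le> (1 - \<beta>) * ?w" .
    with c1 have "?w \<le> real (card (G (insert v S))) + (1 - \<beta>) * ?w" by linarith
    then show ?case by (simp add: algebra_simps)
  qed
  \<comment> \<open>Every event has a nonempty coordinate set, so the empty assignment is good and
    the growth estimate starts from 1.\<close>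
  have pos: "0 < card (G S)" if "S \<subseteq> I" for S
    using finS[OF that] that
  proof (induction S)
    case empty
    have "G {} = {\<lambda>_. undefined}" unfolding G_def using V by auto
    then show ?case by simp
  next
    case (insert v S)
    have "0 < \<beta> * real (card (\<Omega> v)) * real (card (G S))" using insert \<beta> cpos by auto
    also have "\<dots> \<le> real (card (G (insert v S)))" using insert by (intro claim) auto
    finally show ?case by simp
  qed
  then have "G I \<noteq> {}" by (metis card.empty less_irrefl subset_refl)
  then show ?thesis using V unfolding G_def by auto
qed

section \<open>Random bijections, colorings and regular relations\<close>

text \<open>Choose the images of the points of \<open>I\<close> first, with at most \<open>r\<close>
  options each; the rest can be completed in at most \<open>fact (card B - card I)\<close> ways. The
  induction deletes a point and its image, taking a point of \<open>I\<close> as long as there is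
  one.\<close>

lemma card_bijections_constrained:
  assumes "finite B" "finite C" "card B = card C" "I \<subseteq> B"
    and "\<And>b. b \<in> I \<Longrightarrow> finite (R b) \<and> card (R b) \<le> r"
  shows "card {f \<in> B \<rightarrow>\<^sub>E C. bij_betw f B C \<and> (\<forall>b\<in>I. f b \<in> R b)} \<le> r ^ card I * fact (card B - card I)"
  using assms
proof (induction "card B" arbitrary: B C I)
  case 0
  then have "B = {}" "C = {}" "I = {}" by auto
  then show ?case by (simp add: bij_betw_def)
next
  case (Suc n)
  define F where "F B C I = {f \<in> B \<rightarrow>\<^sub>E C. bij_betw f B C \<and> (\<forall>b\<in>I. f b \<in> R b)}" for B C I
  have fin: "finite (F B C I)" if "finite B" "finite C" for B C I
    unfolding F_def using finite_PiE[OF that(1), of "\<lambda>_. C"] that by auto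
  obtain b D where bB: "b \<in> B" and D: "D \<subseteq> C" "F B C I \<subseteq> (\<Union>c\<in>D. {f \<in> F B C I. f b = c})"
    and cD: "card D * (r ^ card (I - {b}) * fact (card (B - {b}) - card (I - {b})))
      \<le> r ^ card I * fact (card B - card I)"
  proof (cases "I = {}")
    case True
    obtain b where b: "b \<in> B" using Suc.hyps(2) by fastforce
    have "card C * fact (card (B - {b})) \<le> (fact (card B) :: nat)"
      using Suc.hyps(2) Suc.prems b by (metis card_Diff_singleton diff_Suc_1 fact_Suc le_refl of_nat_id)
    then show ?thesis using that[OF b, of C] True b by (auto simp: F_def)
  next
    case False
    then obtain b where b: "b \<in> I" by auto
    have "finite I" using Suc.prems finite_subset by blast
    then have ci: "card I = Suc (card (I - {b}))" using b by (metis card_Suc_Diff1)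
    have cb: "card B = Suc (card (B - {b}))" using b Suc.prems by (metis card_Suc_Diff1 subsetD)
    have "card (C \<inter> R b) \<le> r" using Suc.prems(5)[OF b]
      by (meson card_mono inf_le2 le_trans)
    then have "card (C \<inter> R b) * r ^ card (I - {b}) \<le> r ^ card I" unfolding ci by simp
    then have "card (C \<inter> R b) * (r ^ card (I - {b}) * fact (card (B - {b}) - card (I - {b})))
      \<le> r ^ card I * fact (card B - card I)" using ci cb by (simp flip: mult.assoc)
    moreover have "F B C I \<subseteq> (\<Union>c\<in>C \<inter> R b. {f \<in> F B C I. f b = c})"
      using b Suc.prems(4) by (auto simp: F_def PiE_iff)
    ultimately show ?thesis using that[of b "C \<inter> R b"] b Suc.prems(4) by blast
  qed
  have each: "card {f \<in> F B C I. f b = c} \<le> r ^ card (I - {b}) * fact (card (B - {b}) - card (I - {b}))"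
    if c: "c \<in> D" for c
  proof -
    have cC: "c \<in> C" using c D by auto
    have "card {f \<in> F B C I. f b = c} \<le> card (F (B - {b}) (C - {c}) (I - {b}))"
    proof (rule card_inj_on_le[where f = "\<lambda>f. restrict f (B - {b})"])
      show "inj_on (\<lambda>f. restrict f (B - {b})) {f \<in> F B C I. f b = c}"
      proof (rule inj_onI, rule ext)
        fix f g x assume h: "f \<in> {f \<in> F B C I. f b = c}" "g \<in> {f \<in> F B C I. f b = c}"
          "restrict f (B - {b}) = restrict g (B - {b})"
        have "x \<in> B - {b} \<longrightarrow> f x = g x" using fun_cong[OF h(3), of x] by (metis restrict_apply')
        then show "f x = g x" using h(1,2) bB
          by (cases "x \<in> B"; cases "x = b") (auto simp: F_def PiE_iff extensional_def)
      qed
      show "(\<lambda>f. restrict f (B - {b})) ` {f \<in> F B C I. f b = c} \<subseteq> F (B - {b}) (C - {c}) (I - {b})"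
      proof (rule image_subsetI)
        fix f assume f: "f \<in> {f \<in> F B C I. f b = c}"
        then have bf: "bij_betw f B C" and fb: "f b = c" by (auto simp: F_def)
        have "bij_betw f (B - {b}) (C - {c})"
          using bij_betw_DiffI[OF bf, of "{b}" "{c}"] fb bB cC by (simp add: bij_betw_def)
        then have bj: "bij_betw (restrict f (B - {b})) (B - {b}) (C - {c})"
          by (subst bij_betw_cong[where g = f]) auto
        then have "restrict f (B - {b}) \<in> (B - {b}) \<rightarrow>\<^sub>E (C - {c})"
          by (auto simp: PiE_iff dest: bij_betwE)
        then show "restrict f (B - {b}) \<in> F (B - {b}) (C - {c}) (I - {b})"
          using bj f Suc.prems(4) by (auto simp: F_def)
      qed
      show "finite (F (B - {b}) (C - {c}) (I - {b}))" using Suc.prems by (intro fin) auto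
    qed
    also have "\<dots> \<le> r ^ card (I - {b}) * fact (card (B - {b}) - card (I - {b}))"
      unfolding F_def using Suc.hyps(2) Suc.prems bB cC
      by (intro Suc.hyps(1)) (auto simp: card_Diff_singleton)
    finally show ?thesis .
  qed
  have finD: "finite D" using D(1) Suc.prems finite_subset by blast
  have "card (F B C I) \<le> card (\<Union>c\<in>D. {f \<in> F B C I. f b = c})"
    using D(2) finD fin Suc.prems by (intro card_mono) auto
  also have "\<dots> \<le> (\<Sum>c\<in>D. card {f \<in> F B C I. f b = c})" by (rule card_UN_le[OF finD])
  also have "\<dots> \<le> card D * (r ^ card (I - {b}) * fact (card (B - {b}) - card (I - {b})))"
    using sum_bounded_above[of D _ "r ^ card (I - {b}) * fact (card (B - {b}) - card (I - {b}))"] each by auto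
  also note cD
  finally show ?case unfolding F_def .
qed

lemma balanced_coloring_exists:
  assumes "finite C" "card C = u * a + v * b" "0 < a" "0 < b"
  shows "\<exists>g :: 'a \<Rightarrow> nat. \<forall>x\<in>C. card {z \<in> C. g z = g x} \<in> {a, b}"
proof -
  \<comment> \<open>The bound on the colors is added for the induction: it makes the color
    \<open>n\<close> of the newly split block fresh.\<close>
  have "\<exists>g :: 'a \<Rightarrow> nat. (\<forall>x\<in>C. g x < u + v) \<and> (\<forall>x\<in>C. card {z \<in> C. g z = g x} \<in> {a, b})"
    using assms(1,2)
  proof (induction "u + v" arbitrary: u v C)
    case 0
    then show ?case by auto
  next
    case (Suc n)
    obtain c u' v' where c: "c \<in> {a, b}" "u' + v' = n" "card C = c + (u' * a + v' * b)"
    proof (cases u)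
      case 0
      then show ?thesis using that[of b 0 "v - 1"] Suc by (cases v) auto
    next
      case (Suc u')
      then show ?thesis using that[of a u' v] Suc.prems Suc.hyps(2) by auto
    qed
    obtain D where D: "D \<subseteq> C" "card D = c" using c(3) obtain_subset_with_card_n[of c C] by auto
    have fD: "finite D" using D Suc.prems finite_subset by blast
    have "card (C - D) = u' * a + v' * b" using c D fD by (simp add: card_Diff_subset)
    then obtain g :: "'a \<Rightarrow> nat" where g: "\<forall>x\<in>C - D. g x < u' + v'"
        "\<forall>x\<in>C - D. card {z \<in> C - D. g z = g x} \<in> {a, b}"
      using Suc.hyps(1)[of u' v' "C - D"] c(2) Suc.prems by auto
    let ?g = "\<lambda>x. if x \<in> D then n else g x"
    have "card {z \<in> C. ?g z = ?g x} \<in> {a, b}" if "x \<in> C" for x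
    proof (cases "x \<in> D")
      case True
      then have "{z \<in> C. ?g z = ?g x} = D" using g(1) c(2) D by force
      then show ?thesis using D c by auto
    next
      case False
      then have "{z \<in> C. ?g z = ?g x} = {z \<in> C - D. g z = g x}" using g(1) c(2) that by force
      then show ?thesis using g(2) False that by auto
    qed
    moreover have "\<forall>x\<in>C. ?g x < u + v" using g(1) c(2) Suc.hyps(2) by force
    ultimately show ?case by (intro exI[of _ ?g] conjI ballI) blast+
  qed
  then show ?thesis by blast
qed

text \<open>\<open>R u v\<close> says that \<open>v\<close> lies in the cyclic window of length
  \<open>k\<close> starting at \<open>u\<close> modulo \<open>s\<close>; the second disjunct is the
  part that wraps around.\<close>

lemma card_cyclic_window:
  fixes k s :: nat
  assumes "k \<le> s"
  defines "R \<equiv> \<lambda>u v. (u \<le> v \<and> v < u + k) \<or> (v < u \<and> v + s < u + k)"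
  shows "u < s \<Longrightarrow> card {v. v < s \<and> R u v} = k"
    and "v < s \<Longrightarrow> card {u. u < s \<and> R u v} = k"
proof -
  assume u: "u < s"
  have "{v. v < s \<and> R u v} = {u..<min s (u + k)} \<union> {..<u + k - s}"
    using assms u by auto
  also have "card \<dots> = k" using assms u by (subst card_Un_disjoint) auto
  finally show "card {v. v < s \<and> R u v} = k" .
next
  assume v: "v < s"
  have "{u. u < s \<and> R u v} = {v + 1 - k..v} \<union> {v + s + 1 - k..<s}"
    using assms v by auto
  also have "card \<dots> = k" using assms v by (subst card_Un_disjoint) auto
  finally show "card {u. u < s \<and> R u v} = k" .
qed

lemma regular_relation_exists:
  assumes "finite C" "k \<le> card C"
  shows "\<exists>R :: 'a \<Rightarrow> 'a \<Rightarrow> bool. (\<forall>x\<in>C. card {z \<in> C. R x z} = k) \<and> (\<forall>z\<in>C. card {x \<in> C. R x z} = k)"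
proof -
  let ?s = "card C"
  define Q where "Q = (\<lambda>u v. (u \<le> v \<and> v < u + k) \<or> (v < u \<and> v + ?s < u + k))"
  obtain h where h: "bij_betw h C {0..<?s}" using ex_bij_betw_finite_nat[OF assms(1)] by blast
  have hs: "h x < ?s" if "x \<in> C" for x using h that by (auto dest: bij_betwE)
  have cd: "card {z \<in> C. P (h z)} = card {v. v < ?s \<and> P v}" for P
  proof (rule bij_betw_same_card[of h])
    have "h ` {z \<in> C. P (h z)} = {v. v < ?s \<and> P v}"
      using h unfolding bij_betw_def by (auto simp: set_eq_iff image_iff) (metis atLeast0LessThan image_iff lessThan_iff)+
    then show "bij_betw h {z \<in> C. P (h z)} {v. v < ?s \<and> P v}"
      using h unfolding bij_betw_def by (auto intro: inj_on_subset)
  qed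
  show ?thesis
    using hs card_cyclic_window[OF assms(2)] cd[of "Q _"] cd[of "\<lambda>u. Q u _"]
    by (intro exI[of _ "\<lambda>x z. Q (h x) (h z)"]) (simp add: Q_def)
qed

section \<open>Factorial, binomial and moment estimates\<close>

text \<open>The quotient of \<open>fact s\<close> by \<open>fact (s - i)\<close> has
  \<open>i\<close> factors, each at least \<open>s - i \<ge> m - t\<close>. As \<open>m - t\<close>
  does not depend on the class, the estimates of different classes multiply to a single
  power.\<close>

lemma fact_diff_power_le:
  assumes "i \<le> t" "t \<le> m" "m \<le> s"
  shows "fact (s - i) * (m - t) ^ i \<le> (fact s :: nat)"
proof -
  have "fact q * q ^ i \<le> (fact (q + i) :: nat)" for q i :: nat
  proof (induction i)
    case (Suc i)
    have "fact q * q ^ Suc i = q * (fact q * q ^ i)" by simp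
    also have "\<dots> \<le> (q + Suc i) * fact (q + i)" using Suc by (intro mult_mono) auto
    finally show ?case by simp
  qed simp
  from this[of "s - i" i] have "fact (s - i) * (s - i) ^ i \<le> (fact s :: nat)" using assms by simp
  moreover have "(m - t) ^ i \<le> (s - i) ^ i" using assms by (intro power_mono) auto
  ultimately show ?thesis by (meson le_trans mult_le_mono2)
qed

text \<open>Compares falling factorials: that of \<open>N\<close> is at most \<open>N ^ t\<close>,
  that of \<open>a\<close> at least \<open>(a - t) ^ t\<close>.\<close>

lemma binomial_ratio_le:
  assumes "t \<le> a"
  shows "(N choose t) * (a - t) ^ t \<le> (a choose t) * N ^ t"
proof -
  have "fact (a - t) * (a - t) ^ t \<le> (fact a :: nat)" using assms by (intro fact_diff_power_le) auto
  also have "\<dots> = fact t * fact (a - t) * (a choose t)" using binomial_fact_lemma[OF assms] by simp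
  finally have 1: "(a - t) ^ t \<le> fact t * (a choose t)" by (simp add: mult_ac)
  have 2: "(N choose t) * fact t \<le> N ^ t" by (rule binomial_fact_pow)
  have "(N choose t) * (a - t) ^ t \<le> (N choose t) * (fact t * (a choose t))" using 1 by simp
  also have "\<dots> = (N choose t) * fact t * (a choose t)" by simp
  also have "\<dots> \<le> N ^ t * (a choose t)" using 2 by (rule mult_le_mono1)
  finally show ?thesis by (simp add: mult_ac)
qed

lemma card_bijections:
  assumes "finite B" "card B = card C" "finite C"
  shows "card {f \<in> B \<rightarrow>\<^sub>E C. bij_betw f B C} = fact (card B)"
proof (rule antisym)
  show "card {f \<in> B \<rightarrow>\<^sub>E C. bij_betw f B C} \<le> fact (card B)"
    using card_bijections_constrained[of B C "{}" "\<lambda>_. {}" 0] assms by simp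
  obtain g where g: "bij_betw g B C" using assms by (metis finite_same_card_bij)
  have "card {p. p permutes B} \<le> card {f \<in> B \<rightarrow>\<^sub>E C. bij_betw f B C}"
  proof (rule card_inj_on_le[where f = "\<lambda>p. restrict (g \<circ> p) B"])
    show "inj_on (\<lambda>p. restrict (g \<circ> p) B) {p. p permutes B}"
    proof (rule inj_onI, rule ext)
      fix p q x assume h: "p \<in> {p. p permutes B}" "q \<in> {p. p permutes B}"
        "restrict (g \<circ> p) B = restrict (g \<circ> q) B"
      show "p x = q x"
      proof (cases "x \<in> B")
        case True
        then have "g (p x) = g (q x)" using fun_cong[OF h(3), of x] by simp
        moreover have "p x \<in> B" "q x \<in> B" using True h(1,2) by (auto simp: permutes_in_image)
        ultimately show ?thesis using g by (auto simp: bij_betw_def inj_on_def)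
      next
        case False
        then show ?thesis using h(1,2) by (auto simp: permutes_def)
      qed
    qed
    show "(\<lambda>p. restrict (g \<circ> p) B) ` {p. p permutes B} \<subseteq> {f \<in> B \<rightarrow>\<^sub>E C. bij_betw f B C}"
    proof (rule image_subsetI)
      fix p assume "p \<in> {p. p permutes B}"
      then have "bij_betw (g \<circ> p) B C" using g by (auto intro: bij_betw_trans permutes_imp_bij)
      then have b: "bij_betw (restrict (g \<circ> p) B) B C" by (subst bij_betw_cong[where g = "g \<circ> p"]) auto
      then show "restrict (g \<circ> p) B \<in> {f \<in> B \<rightarrow>\<^sub>E C. bij_betw f B C}" by (auto dest: bij_betwE)
    qed
    show "finite {f \<in> B \<rightarrow>\<^sub>E C. bij_betw f B C}" using finite_PiE[OF assms(1), of "\<lambda>_. C"] assms by auto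
  qed
  then show "fact (card B) \<le> card {f \<in> B \<rightarrow>\<^sub>E C. bij_betw f B C}"
    using card_permutations[OF refl assms(1)] by simp
qed

text \<open>Markov's inequality for the number of \<open>t\<close>-subsets of \<open>H f\<close>, by
  double counting the pairs \<open>(f, T)\<close> with \<open>T \<subseteq> H f\<close>. It serves
  as the tail bound for a single line.\<close>

lemma markov_subsets_count:
  assumes "finite F" "finite W"
    and "\<And>T. T \<subseteq> W \<Longrightarrow> card T = t \<Longrightarrow> real (card {f \<in> F. T \<subseteq> H f}) \<le> B"
    and "\<And>f. f \<in> F \<Longrightarrow> H f \<subseteq> W"
  shows "real (card {f \<in> F. a \<le> card (H f)}) * real (a choose t) \<le> real (card W choose t) * B"
proof -
  define TT where "TT = {T. T \<subseteq> W \<and> card T = t}"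
  have finT: "finite TT" unfolding TT_def using assms(2) by auto
  let ?F = "{f \<in> F. a \<le> card (H f)}"
  have "real (card ?F) * real (a choose t) = (\<Sum>f\<in>?F. real (a choose t))" by simp
  also have "\<dots> \<le> (\<Sum>f\<in>?F. \<Sum>T\<in>{T \<in> TT. T \<subseteq> H f}. 1)"
  proof (rule sum_mono)
    fix f assume f: "f \<in> ?F"
    then have HW: "H f \<subseteq> W" using assms(4) by auto
    then have "{T \<in> TT. T \<subseteq> H f} = {T. T \<subseteq> H f \<and> card T = t}" unfolding TT_def by auto
    then have "card {T \<in> TT. T \<subseteq> H f} = card (H f) choose t"
      using n_subsets HW assms(2) finite_subset by metis
    moreover have "a choose t \<le> card (H f) choose t" using f by (intro binomial_right_mono) auto
    ultimately show "real (a choose t) \<le> (\<Sum>T\<in>{T \<in> TT. T \<subseteq> H f}. 1)" by simp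
  qed
  also have "\<dots> = (\<Sum>T\<in>TT. \<Sum>f\<in>{f \<in> ?F. T \<subseteq> H f}. 1)"
    using finT assms(1) by (intro sum.swap_restrict) auto
  also have "\<dots> \<le> (\<Sum>T\<in>TT. B)"
  proof (rule sum_mono)
    fix T assume "T \<in> TT"
    then have "real (card {f \<in> F. T \<subseteq> H f}) \<le> B" using assms(3) unfolding TT_def by auto
    moreover have "card {f \<in> ?F. T \<subseteq> H f} \<le> card {f \<in> F. T \<subseteq> H f}"
      using assms(1) by (intro card_mono) auto
    ultimately show "(\<Sum>f\<in>{f \<in> ?F. T \<subseteq> H f}. 1) \<le> B" by simp
  qed
  also have "\<dots> = real (card W choose t) * B" unfolding TT_def using n_subsets[OF assms(2)] by simp
  finally show ?thesis .
qed

text \<open>The left side is largest at \<open>v = D\<close>, where it equals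
  \<open>(1 + 1 / (D - 1)) ^ (D - 1)\<close>, which is at most Euler's number. This is the price of
  the powers of \<open>\<beta>\<close> in the local lemma for
  \<open>\<beta> = 1 - 1 / D\<close>.\<close>

lemma local_lemma_weight_bound:
  assumes "2 \<le> D" "v \<le> (D :: nat)"
  shows "1 / (1 - 1 / real D) ^ (v - 1) \<le> 3"
proof -
  let ?\<beta> = "1 - 1 / real D"
  have b: "0 < ?\<beta>" "?\<beta> \<le> 1" using assms by auto
  have inv: "1 / ?\<beta> = 1 + 1 / real (D - 1)" using assms by (simp add: field_simps of_nat_diff)
  have "1 / ?\<beta> ^ (v - 1) \<le> 1 / ?\<beta> ^ (D - 1)"
    using b assms by (intro divide_left_mono power_decreasing) auto
  also have "\<dots> = (1 + 1 / real (D - 1)) ^ (D - 1)" using inv by (simp add: power_one_over[symmetric] del: power_one_over)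
  also have "\<dots> \<le> exp (1 / real (D - 1)) ^ (D - 1)"
    by (intro power_mono exp_ge_add_one_self) auto
  also have "\<dots> = exp 1" using assms by (simp flip: exp_of_nat_mult)
  also have "\<dots> \<le> 3" by (rule exp_le)
  finally show ?thesis .
qed

text \<open>
  The hypothesis \<open>thr\<close> is the union bound over the \<open>t\<close>-subsets of the surviving points of a line: a fixed
  \<open>t\<close>-subset survives with probability at most \<open>(r / (m - t))\<close> to the power \<open>t\<close>.
\<close>

lemma random_bijection_step:
  fixes ca :: "'a \<Rightarrow> 'j" and cb :: "'b \<Rightarrow> 'j" and A :: "('a \<times> 'b) set set" and a :: "('a \<times> 'b) set \<Rightarrow> nat"
  assumes fin: "finite X" "finite Y" "finite A"
    and lab: "cb ` Y \<subseteq> ca ` X"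
    and sz: "\<And>j. j \<in> ca ` X \<Longrightarrow> card {y \<in> Y. cb y = j} = card {x \<in> X. ca x = j}
      \<and> m \<le> card {x \<in> X. ca x = j} \<and> card {x \<in> X. ca x = j} \<le> m + 1"
    and R: "\<And>x. x \<in> X \<Longrightarrow> card {z \<in> X. R x z} \<le> r"
    and Rca: "\<And>x z. x \<in> X \<Longrightarrow> z \<in> X \<Longrightarrow> R x z \<Longrightarrow> ca x = ca z"
    and A: "\<And>P. P \<in> A \<Longrightarrow> P \<subseteq> X \<times> Y \<and> inj_on snd P"
    and D: "2 \<le> D" "\<And>P. P \<in> A \<Longrightarrow> card {p \<in> P. ca (fst p) = cb (snd p)} \<le> D"
    and H: "\<And>p. p \<in> X \<times> Y \<Longrightarrow> card {P \<in> A. p \<in> P} \<le> H"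
    and Q: "0 < Q" "3 * (real m + 1)\<^sup>2 * real H * real D \<le> Q"
    and thr: "\<And>P. P \<in> A \<Longrightarrow> \<exists>t. t < m \<and> t < a P \<and>
      (real (card {p \<in> P. ca (fst p) = cb (snd p)}) * real r) ^ t * Q
        \<le> ((real (a P) - real t) * (real m - real t)) ^ t"
  shows "\<exists>\<phi>. bij_betw \<phi> Y X \<and> (\<forall>y\<in>Y. ca (\<phi> y) = cb y) \<and>
    (\<forall>P\<in>A. card {p \<in> P. R (fst p) (\<phi> (snd p))} < a P)"
proof -
  \<comment> \<open>The coordinates of the local lemma are the class labels \<open>j\<close>, and
    the value at \<open>j\<close> is a bijection from row class to column class. \<open>W P\<close>
    holds the points of \<open>P\<close> still alive and \<open>V P\<close> the labels they
    use.\<close>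
  define Xc where "Xc j = {x \<in> X. ca x = j}" for j
  define Yc where "Yc j = {y \<in> Y. cb y = j}" for j
  define \<Omega> where "\<Omega> j = {f \<in> Yc j \<rightarrow>\<^sub>E Xc j. bij_betw f (Yc j) (Xc j)}" for j
  define W where "W P = {p \<in> P. ca (fst p) = cb (snd p)}" for P
  define V where "V P = cb ` snd ` W P" for P
  define hits where "hits P f = {p \<in> W P. R (fst p) (f (cb (snd p)) (snd p))}" for P f
  define Bad where "Bad P f \<longleftrightarrow> a P \<le> card (hits P f)" for P f
  define J where "J = ca ` X"
  define \<beta> where "\<beta> = 1 - 1 / real D"
  \<comment> \<open>Sets without live points are set aside, because the local lemma asks for
    nonempty coordinate sets; they can receive no hits.\<close>
  define K where "K = {P \<in> A. W P \<noteq> {}}"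
  have finc: "finite (Xc j)" "finite (Yc j)" for j using fin unfolding Xc_def Yc_def by auto
  have szj: "card (Yc j) = card (Xc j)" "m \<le> card (Xc j)" "card (Xc j) \<le> m + 1" if "j \<in> J" for j
    using sz[of j] that unfolding J_def Xc_def Yc_def by auto
  have c\<Omega>: "card (\<Omega> j) = fact (card (Xc j))" if "j \<in> J" for j
    unfolding \<Omega>_def using card_bijections[OF finc(2) szj(1)[OF that] finc(1)] szj(1)[OF that] by simp
  have fin\<Omega>: "finite (\<Omega> j)" for j
    unfolding \<Omega>_def using finite_PiE[OF finc(2), of j "\<lambda>_. Xc j"] finc by auto
  have finP: "finite P" if "P \<in> A" for P using A[OF that] fin finite_subset by blast
  have finW: "finite (W P)" if "P \<in> A" for P using finP[OF that] unfolding W_def by auto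
  have VJ: "V P \<subseteq> J" if "P \<in> A" for P
    using A[OF that] lab unfolding V_def W_def J_def by force
  have prob: "real (card {f \<in> PiE (V P) \<Omega>. Bad P f}) \<le> 1 / Q * (\<Prod>i\<in>V P. real (card (\<Omega> i)))"
    if P: "P \<in> A" for P
  proof -
    obtain t where t: "t < m" "t < a P" and
      tQ: "(real (card (W P)) * real r) ^ t * Q \<le> ((real (a P) - real t) * (real m - real t)) ^ t"
      using thr[OF P] unfolding W_def by auto
    let ?pr = "\<Prod>i\<in>V P. real (card (\<Omega> i))"
    have finV: "finite (V P)" using finW[OF P] unfolding V_def by auto
    \<comment> \<open>Distinct points of \<open>T\<close> have distinct rows, so \<open>T\<close>
      constrains the images of \<open>t\<close> different rows. \<open>I j\<close> collects those in
      class \<open>j\<close>, \<open>S y\<close> the columns allowed for row \<open>y\<close>; the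
      classes are independent, so their bounds multiply.\<close>
    have each: "real (card {f \<in> PiE (V P) \<Omega>. T \<subseteq> hits P f}) \<le> (real r / real (m - t)) ^ t * ?pr"
      if T: "T \<subseteq> W P" "card T = t" for T
    proof -
      have finT: "finite T" using T finW[OF P] finite_subset by blast
      have TP: "T \<subseteq> P" using T unfolding W_def by auto
      have injT: "inj_on snd T" using A[OF P] TP by (auto intro: inj_on_subset)
      define I where "I j = {y \<in> snd ` T. cb y = j}" for j
      define S where "S y = {z \<in> X. R (fst (the_inv_into T snd y)) z}" for y
      have inv: "the_inv_into T snd (snd p) = p" if "p \<in> T" for p
        using injT that by (simp add: the_inv_into_f_f)
      define E where "E j = {f \<in> \<Omega> j. \<forall>y\<in>I j. f y \<in> S y}" for j
      have IY: "I j \<subseteq> Yc j" for j using TP A[OF P] unfolding I_def Yc_def by force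
      have "{f \<in> PiE (V P) \<Omega>. T \<subseteq> hits P f} \<subseteq> PiE (V P) E"
      proof
        fix f assume f: "f \<in> {f \<in> PiE (V P) \<Omega>. T \<subseteq> hits P f}"
        have "f j \<in> E j" if j: "j \<in> V P" for j
        proof -
          have fj: "f j \<in> \<Omega> j" using f j by auto
          have "f j y \<in> S y" if y: "y \<in> I j" for y
          proof -
            obtain p where p: "p \<in> T" "y = snd p" "cb y = j" using y unfolding I_def by auto
            have "R (fst p) (f j y)" using f p unfolding hits_def by auto
            moreover have "f j y \<in> X" using fj IY[of j] y unfolding \<Omega>_def Xc_def by (auto simp: PiE_iff)
            ultimately show ?thesis unfolding S_def using inv p by simp
          qed
          then show ?thesis using fj unfolding E_def by auto
        qed
        then show "f \<in> PiE (V P) E" using f by (auto simp: PiE_iff)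
      qed
      then have "card {f \<in> PiE (V P) \<Omega>. T \<subseteq> hits P f} \<le> card (PiE (V P) E)"
        using fin\<Omega> finV by (intro card_mono finite_PiE) (auto simp: E_def)
      also have "\<dots> = (\<Prod>j\<in>V P. card (E j))" by (rule card_PiE[OF finV])
      finally have c1: "real (card {f \<in> PiE (V P) \<Omega>. T \<subseteq> hits P f}) \<le> (\<Prod>j\<in>V P. real (card (E j)))"
        unfolding of_nat_prod[symmetric] of_nat_le_iff .
      have cI: "card (I j) \<le> t" for j
      proof -
        have "card (I j) \<le> card (snd ` T)" unfolding I_def using finT by (intro card_mono) auto
        also have "\<dots> = t" using injT T by (simp add: card_image)
        finally show ?thesis .
      qed
      have "real (card (E j)) \<le> (real r / real (m - t)) ^ card (I j) * real (card (\<Omega> j))" if j: "j \<in> V P" for j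
      proof -
        have jJ: "j \<in> J" using VJ[OF P] j by auto
        have "finite (S y) \<and> card (S y) \<le> r" if "y \<in> I j" for y
        proof -
          obtain p where p: "p \<in> T" "y = snd p" using \<open>y \<in> I j\<close> unfolding I_def by auto
          have "fst p \<in> X" using p TP A[OF P] by force
          then show ?thesis unfolding S_def using inv p R fin by auto
        qed
        then have "card (E j) \<le> r ^ card (I j) * fact (card (Yc j) - card (I j))"
          using card_bijections_constrained[OF finc(2) finc(1) szj(1)[OF jJ] IY, of S r]
          unfolding E_def \<Omega>_def by (simp add: conj_assoc)
        then have "card (E j) * (m - t) ^ card (I j) \<le> r ^ card (I j) * (fact (card (Xc j) - card (I j)) * (m - t) ^ card (I j))"
          unfolding szj(1)[OF jJ] by (simp add: mult_le_mono1 flip: mult.assoc)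
        also have "\<dots> \<le> r ^ card (I j) * card (\<Omega> j)"
          unfolding c\<Omega>[OF jJ] using cI szj(2)[OF jJ] t by (intro mult_le_mono2 fact_diff_power_le) auto
        finally have "real (card (E j)) * real (m - t) ^ card (I j) \<le> real r ^ card (I j) * real (card (\<Omega> j))"
          unfolding of_nat_power[symmetric] of_nat_mult[symmetric] of_nat_le_iff .
        then show ?thesis using t by (simp add: power_divide field_simps)
      qed
      then have "(\<Prod>j\<in>V P. real (card (E j))) \<le> (\<Prod>j\<in>V P. (real r / real (m - t)) ^ card (I j) * real (card (\<Omega> j)))"
        by (intro prod_mono) auto
      also have "\<dots> = (real r / real (m - t)) ^ (\<Sum>j\<in>V P. card (I j)) * ?pr"
        by (simp add: prod.distrib power_sum)
      also have "(\<Sum>j\<in>V P. card (I j)) = t"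
      proof -
        have "(\<Sum>j\<in>V P. \<Sum>y\<in>{y \<in> snd ` T. cb y = j}. 1) = (\<Sum>y\<in>snd ` T. 1 :: nat)"
          using finT finV T unfolding V_def by (intro sum.group) auto
        then show ?thesis unfolding I_def using injT T by (simp add: card_image)
      qed
      finally show ?thesis using c1 by linarith
    qed
    have finPi: "finite (PiE (V P) \<Omega>)" using finV fin\<Omega> by (intro finite_PiE) auto
    have mk: "real (card {f \<in> PiE (V P) \<Omega>. Bad P f}) * real (a P choose t)
        \<le> real (card (W P) choose t) * ((real r / real (m - t)) ^ t * ?pr)"
      unfolding Bad_def using finPi finW[OF P] each
      by (intro markov_subsets_count) (auto simp: hits_def)
    let ?b = "real (card {f \<in> PiE (V P) \<Omega>. Bad P f})"
    let ?N = "real (card (W P))"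
    have chp: "0 < real (a P choose t)" using t by (simp add: zero_less_binomial)
    have mt: "0 < real (m - t) ^ t" "0 < real (a P - t) ^ t" using t by auto
    have br: "real (card (W P) choose t) * real (a P - t) ^ t \<le> real (a P choose t) * ?N ^ t"
      using binomial_ratio_le[of t "a P" "card (W P)"] t
      unfolding of_nat_power[symmetric] of_nat_mult[symmetric] of_nat_le_iff by simp
    have prn: "0 \<le> ?pr" by (intro prod_nonneg) auto
    have "?b * real (m - t) ^ t * real (a P choose t) \<le> real (card (W P) choose t) * real r ^ t * ?pr"
      using mult_right_mono[OF mk, of "real (m - t) ^ t"] mt t by (simp add: power_divide field_simps)
    then have "?b * real (m - t) ^ t * real (a P choose t) * real (a P - t) ^ t
        \<le> (real (card (W P) choose t) * real (a P - t) ^ t) * (real r ^ t * ?pr)"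
      using mt by (simp add: mult_ac)
    also have "\<dots> \<le> (real (a P choose t) * ?N ^ t) * (real r ^ t * ?pr)"
      using br prn by (intro mult_right_mono) auto
    finally have "real (a P choose t) * (?b * (real (m - t) * real (a P - t)) ^ t)
        \<le> real (a P choose t) * ((?N * real r) ^ t * ?pr)" by (simp add: power_mult_distrib mult_ac)
    then have s1: "?b * (real (m - t) * real (a P - t)) ^ t \<le> (?N * real r) ^ t * ?pr" using chp by simp
    let ?M = "(real (m - t) * real (a P - t)) ^ t"
    have Mp: "0 < ?M" using t by auto
    have tQ': "(?N * real r) ^ t * Q \<le> ?M" using tQ t by (simp add: of_nat_diff mult_ac)
    have "?b * Q * ?M \<le> (?N * real r) ^ t * Q * ?pr"
      using mult_right_mono[OF s1, of Q] Q(1) by (simp add: mult_ac)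
    also have "\<dots> \<le> ?M * ?pr" using tQ' prn by (intro mult_right_mono) auto
    finally have "?b * Q \<le> ?pr" using Mp by (simp add: mult.commute)
    then show ?thesis using Q(1) by (simp add: field_simps)
  qed
  \<comment> \<open>A set using label \<open>v\<close> contains one of at most
    \<open>(m + 1)\<^sup>2\<close> points of \<open>Xc v \<times> Yc v\<close>, each lying in at
    most \<open>H\<close> sets, and each set contributes at most \<open>3 / Q\<close>. By the
    hypothesis on \<open>Q\<close> the total is at most \<open>1 / D = 1 - \<beta>\<close>.\<close>
  have sumb: "(\<Sum>P | P \<in> K \<and> v \<in> V P. 1 / Q / \<beta> ^ (card (V P) - 1)) \<le> 1 - \<beta>" if v: "v \<in> J" for v
  proof -
    let ?K = "{P. P \<in> K \<and> v \<in> V P}"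
    have "?K \<subseteq> (\<Union>p\<in>Xc v \<times> Yc v. {P \<in> A. p \<in> P})"
    proof
      fix P assume P: "P \<in> ?K"
      then obtain p where p: "p \<in> W P" "cb (snd p) = v" unfolding V_def by auto
      then have "p \<in> P" "p \<in> Xc v \<times> Yc v" "P \<in> A"
        using P A[of P] unfolding K_def W_def Xc_def Yc_def by (cases p; force)+
      then show "P \<in> (\<Union>p\<in>Xc v \<times> Yc v. {P \<in> A. p \<in> P})" by blast
    qed
    then have "card ?K \<le> card (\<Union>p\<in>Xc v \<times> Yc v. {P \<in> A. p \<in> P})"
      using fin finc by (intro card_mono) auto
    also have "\<dots> \<le> (\<Sum>p\<in>Xc v \<times> Yc v. card {P \<in> A. p \<in> P})" using finc by (intro card_UN_le) auto
    also have "\<dots> \<le> of_nat (card (Xc v \<times> Yc v)) * H"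
      using H unfolding Xc_def Yc_def by (intro sum_bounded_above) auto
    finally have cK: "card ?K \<le> card (Xc v) * card (Yc v) * H" by (simp add: card_cartesian_product)
    have "card (Xc v) * card (Yc v) * H \<le> (m + 1) * (m + 1) * H"
      using szj[OF v] by (intro mult_le_mono) auto
    with cK have cK: "card ?K \<le> (m + 1)\<^sup>2 * H" by (simp add: power2_eq_square)
    have "(\<Sum>P\<in>?K. 1 / Q / \<beta> ^ (card (V P) - 1)) \<le> (\<Sum>P\<in>?K. 1 / Q * 3)"
    proof (rule sum_mono)
      fix P assume P: "P \<in> ?K"
      then have PA: "P \<in> A" unfolding K_def by auto
      have "card (V P) \<le> card (W P)" unfolding V_def using finW[OF PA]
        by (metis card_image_le finite_imageI le_trans)
      also have "\<dots> \<le> D" using D(2)[OF PA] unfolding W_def .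
      finally have "1 / \<beta> ^ (card (V P) - 1) \<le> 3" unfolding \<beta>_def by (intro local_lemma_weight_bound D)
      then show "1 / Q / \<beta> ^ (card (V P) - 1) \<le> 1 / Q * 3"
        using Q(1) mult_left_mono[of "1 / \<beta> ^ (card (V P) - 1)" 3 "1 / Q"] by simp
    qed
    also have "\<dots> = real (card ?K) * (3 / Q)" by simp
    also have "\<dots> \<le> real ((m + 1)\<^sup>2 * H) * (3 / Q)"
      using cK Q(1) by (intro mult_right_mono of_nat_mono) auto
    also have "\<dots> \<le> 1 / real D"
      using Q D(1) by (simp add: field_simps power2_eq_square)
    finally show ?thesis unfolding \<beta>_def by simp
  qed
  have "\<exists>f \<in> PiE J \<Omega>. \<forall>P\<in>K. \<not> Bad P f"
  proof (rule local_lemma_product[where V = V and p = "\<lambda>_. 1 / Q" and \<beta> = \<beta>])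
    show "finite J" unfolding J_def using fin by auto
    show "finite K" unfolding K_def using fin by auto
    show "finite (\<Omega> i) \<and> \<Omega> i \<noteq> {}" if "i \<in> J" for i
      using fin\<Omega>[of i] c\<Omega>[OF that] by (metis card.empty fact_nonzero)
    show "V P \<subseteq> J \<and> V P \<noteq> {}" if "P \<in> K" for P
      using that VJ unfolding K_def V_def by auto
    show "Bad P f = Bad P g" if "P \<in> K" "\<And>i. i \<in> V P \<Longrightarrow> f i = g i" for P f g
    proof -
      have "f (cb (snd p)) = g (cb (snd p))" if "p \<in> W P" for p
        using that by (intro \<open>\<And>i. i \<in> V P \<Longrightarrow> f i = g i\<close>) (auto simp: V_def)
      then have "hits P f = hits P g" unfolding hits_def by auto
      then show ?thesis unfolding Bad_def by simp
    qed
    show "real (card {f \<in> PiE (V P) \<Omega>. Bad P f}) \<le> 1 / Q * (\<Prod>i\<in>V P. real (card (\<Omega> i)))" if "P \<in> K" for P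
      using that by (intro prob) (auto simp: K_def)
    show "0 < \<beta>" using D(1) unfolding \<beta>_def by auto
  qed (rule sumb)
  then obtain f where f: "f \<in> PiE J \<Omega>" "\<And>P. P \<in> K \<Longrightarrow> \<not> Bad P f" by blast
  define \<phi> where "\<phi> y = f (cb y) y" for y
  have fj: "bij_betw (f j) (Yc j) (Xc j)" if "j \<in> J" for j using f(1) that unfolding \<Omega>_def by auto
  have \<phi>: "\<phi> y \<in> X \<and> ca (\<phi> y) = cb y" if "y \<in> Y" for y
  proof -
    have "cb y \<in> J" using lab that unfolding J_def by auto
    then have "f (cb y) y \<in> Xc (cb y)" using fj[of "cb y"] that by (auto dest: bij_betwE simp: Yc_def)
    then show ?thesis unfolding \<phi>_def Xc_def by auto
  qed
  have "bij_betw \<phi> Y X"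
  proof (rule bij_betw_imageI)
    show "inj_on \<phi> Y"
    proof (rule inj_onI)
      fix y z assume h: "y \<in> Y" "z \<in> Y" "\<phi> y = \<phi> z"
      then have e: "cb y = cb z" using \<phi> by metis
      have "cb y \<in> J" using lab h unfolding J_def by auto
      then have "inj_on (f (cb y)) (Yc (cb y))" using fj by (auto simp: bij_betw_def)
      then show "y = z" using h e unfolding \<phi>_def Yc_def by (auto dest: inj_onD)
    qed
    show "\<phi> ` Y = X"
    proof
      show "\<phi> ` Y \<subseteq> X" using \<phi> by auto
      show "X \<subseteq> \<phi> ` Y"
      proof
        fix x assume x: "x \<in> X"
        then have "x \<in> f (ca x) ` Yc (ca x)" using fj[of "ca x"] unfolding bij_betw_def J_def Xc_def by auto
        then obtain y where "y \<in> Y" "cb y = ca x" "x = f (ca x) y" unfolding Yc_def by auto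
        then show "x \<in> \<phi> ` Y" unfolding \<phi>_def by (intro image_eqI[of _ _ y]) auto
      qed
    qed
  qed
  moreover have "card {p \<in> P. R (fst p) (\<phi> (snd p))} < a P" if P: "P \<in> A" for P
  proof -
    \<comment> \<open>\<open>R\<close> stays inside the column classes and \<open>\<phi>\<close>
      respects labels, so every hit is a live point.\<close>
    have e: "{p \<in> P. R (fst p) (\<phi> (snd p))} = hits P f"
      using A[OF P] \<phi> Rca unfolding hits_def W_def \<phi>_def by fastforce
    show ?thesis
    proof (cases "P \<in> K")
      case True then show ?thesis using f(2) e unfolding Bad_def by (simp add: not_le)
    next
      case False
      then have "hits P f = {}" using P unfolding K_def hits_def by auto
      then have "card {p \<in> P. R (fst p) (\<phi> (snd p))} = 0" unfolding e by simp
      moreover have "0 < a P" using thr[OF P] by auto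
      ultimately show ?thesis by simp
    qed
  qed
  ultimately show ?thesis using \<phi> by blast
qed

section \<open>Oblique lines in the grid\<close>

text \<open>Natural coordinates; the random construction sees a line only as this finite set of
  pairs.\<close>

definition grid_trace :: "nat \<Rightarrow> (real \<times> real) set \<Rightarrow> (nat \<times> nat) set" where
  "grid_trace n L = {p \<in> {1..n} \<times> {1..n}. (real (fst p), real (snd p)) \<in> L}"

definition oblique_traces :: "nat \<Rightarrow> (nat \<times> nat) set set" where
  "oblique_traces n = grid_trace n ` (grid_lines n - range horizontal_line - range vertical_line)"

lemma card_grid_Int: "card (grid n \<inter> L) = card (grid_trace n L)"
proof (rule bij_betw_same_card[symmetric, of "\<lambda>p. (real (fst p), real (snd p))"])
  show "bij_betw (\<lambda>p. (real (fst p), real (snd p))) (grid_trace n L) (grid n \<inter> L)"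
    unfolding bij_betw_def inj_on_def grid_trace_def grid_def by (auto simp: image_iff prod_eq_iff)
qed

lemma affine_line_eq_hull:
  fixes p q :: "'a :: euclidean_space"
  assumes "affine L" "aff_dim L = 1" "p \<in> L" "q \<in> L" "p \<noteq> q"
  shows "L = affine hull {p, q}"
proof (rule affine_dim_equal[symmetric])
  show "affine hull {p, q} \<subseteq> L" using assms by (intro hull_minimal) auto
  show "aff_dim (affine hull {p, q}) = aff_dim L" using assms by (simp add: aff_dim_2)
qed (use assms in auto)

lemma affine_line_parametrization:
  fixes p q :: "'a :: euclidean_space"
  assumes "affine L" "aff_dim L = 1" "p \<in> L" "q \<in> L" "p \<noteq> q"
  shows "L = {p + t *\<^sub>R (q - p) | t. True}"
  unfolding affine_line_eq_hull[OF assms] by (auto simp: affine_hull_2_alt)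

text \<open>\<open>p + (q2 - q1)\<close> is an affine combination of points of \<open>L\<close>, so
  the difference of any two points is a direction at any base point. A line through a fixed point
  can thus be recovered from one difference vector.\<close>

lemma affine_line_determined:
  fixes p :: "'a :: euclidean_space"
  assumes "affine L" "aff_dim L = 1" "p \<in> L" "q1 \<in> L" "q2 \<in> L" "q1 \<noteq> q2"
  shows "L = {p + t *\<^sub>R (q2 - q1) | t. True}"
proof -
  have "p + (q2 - q1) \<in> L"
  proof -
    have "1 *\<^sub>R p + 1 *\<^sub>R q2 + (-1) *\<^sub>R q1 \<in> L"
      using mem_affine_3[OF assms(1,3,5,4), of 1 1 "-1"] by simp
    then show ?thesis by (simp add: algebra_simps)
  qed
  then show ?thesis using affine_line_parametrization[OF assms(1-3), of "p + (q2 - q1)"] assms(6) by simp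
qed

text \<open>Two distinct points agreeing in a coordinate force the parametrized line to be vertical
  or horizontal. This makes both projections injective on oblique lines.\<close>

lemma oblique_line_coords:
  assumes L: "affine L" "aff_dim L = 1" and pq: "p \<in> L" "q \<in> L"
  shows "L \<notin> range vertical_line \<Longrightarrow> fst p = fst q \<Longrightarrow> p = q"
    and "L \<notin> range horizontal_line \<Longrightarrow> snd p = snd q \<Longrightarrow> p = q"
proof -
  have mem: "z \<in> L \<longleftrightarrow> (\<exists>t. z = p + t *\<^sub>R (q - p))" if "p \<noteq> q" for z
    by (subst affine_line_parametrization[OF L pq that]) blast
  have "L = vertical_line (fst p)" if h: "fst p = fst q" "p \<noteq> q"
  proof -
    have s: "snd q - snd p \<noteq> 0" using h by (auto simp: prod_eq_iff)
    have "z \<in> L \<longleftrightarrow> fst z = fst p" for z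
    proof
      assume "z \<in> L" then show "fst z = fst p" unfolding mem[OF h(2)] using h(1) by auto
    next
      assume "fst z = fst p"
      then have "z = p + ((snd z - snd p) / (snd q - snd p)) *\<^sub>R (q - p)"
        using h(1) s by (simp add: prod_eq_iff)
      then show "z \<in> L" unfolding mem[OF h(2)] by blast
    qed
    then show ?thesis unfolding vertical_line_def by auto
  qed
  then show "L \<notin> range vertical_line \<Longrightarrow> fst p = fst q \<Longrightarrow> p = q" by blast
  have "L = horizontal_line (snd p)" if h: "snd p = snd q" "p \<noteq> q"
  proof -
    have s: "fst q - fst p \<noteq> 0" using h by (auto simp: prod_eq_iff)
    have "z \<in> L \<longleftrightarrow> snd z = snd p" for z
    proof
      assume "z \<in> L" then show "snd z = snd p" unfolding mem[OF h(2)] using h(1) by auto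
    next
      assume "snd z = snd p"
      then have "z = p + ((fst z - fst p) / (fst q - fst p)) *\<^sub>R (q - p)"
        using h(1) s by (simp add: prod_eq_iff)
      then show "z \<in> L" unfolding mem[OF h(2)] by blast
    qed
    then show ?thesis unfolding horizontal_line_def by auto
  qed
  then show "L \<notin> range horizontal_line \<Longrightarrow> snd p = snd q \<Longrightarrow> p = q" by blast
qed

lemma oblique_trace_inj:
  assumes "P \<in> oblique_traces n"
  shows "P \<subseteq> {1..n} \<times> {1..n}" "inj_on fst P" "inj_on snd P" "card P \<le> n" "2 \<le> card P"
proof -
  obtain L where L: "P = grid_trace n L" "affine L" "aff_dim L = 1" "2 \<le> card (grid n \<inter> L)"
      "L \<notin> range vertical_line" "L \<notin> range horizontal_line"
    using assms unfolding oblique_traces_def grid_lines_def by auto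
  show P: "P \<subseteq> {1..n} \<times> {1..n}" unfolding L grid_trace_def by auto
  have "p = q" if "p \<in> P" "q \<in> P" "fst p = fst q \<or> snd p = snd q" for p q
  proof -
    have "(real (fst p), real (snd p)) = (real (fst q), real (snd q))"
      using that oblique_line_coords[OF L(2,3), of "(real (fst p), real (snd p))" "(real (fst q), real (snd q))"] L(5,6)
      unfolding L(1) grid_trace_def by auto
    then show ?thesis by (simp add: prod_eq_iff)
  qed
  then show i: "inj_on fst P" "inj_on snd P" unfolding inj_on_def by blast+
  have "fst ` P \<subseteq> {1..n}" using P by auto
  then show "card P \<le> n" using card_inj_on_le[OF i(1), of "{1..n}"] by simp
  show "2 \<le> card P" using L(1,4) by (simp add: card_grid_Int)
qed

section \<open>Counting heavy lines through a grid point\<close>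

text \<open>Cut \<open>{1..n}\<close> into intervals of length \<open>2 * M\<close>. Since
  \<open>card P \<ge> 2\<close>, one has
  \<open>n \<le> M * card P \<le> 2 * M * (card P - 1)\<close>, so there are fewer intervals than
  points and two points share one.\<close>

lemma pigeonhole_close_pair:
  fixes f :: "'a \<Rightarrow> nat"
  assumes "f ` P \<subseteq> {1..n}" "2 \<le> card P" "n \<le> M * card P" "1 \<le> M"
  shows "\<exists>p\<in>P. \<exists>q\<in>P. p \<noteq> q \<and> \<bar>int (f p) - int (f q)\<bar> \<le> 2 * int M"
proof -
  let ?g = "\<lambda>p. (f p - 1) div (2 * M)"
  have "\<not> inj_on ?g P"
  proof
    assume i: "inj_on ?g P"
    have "?g ` P \<subseteq> {0..(n - 1) div (2 * M)}" using assms(1) by (intro image_subsetI) (auto intro!: div_le_mono diff_le_mono)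
    then have "card P \<le> (n - 1) div (2 * M) + 1"
      using card_inj_on_le[OF i, of "{0..(n - 1) div (2 * M)}"] by simp
    moreover have "(n - 1) div (2 * M) \<le> card P - 2 \<or> (n - 1) div (2 * M) < card P - 1"
    proof -
      have "n - 1 < 2 * M * (card P - 1)"
      proof -
        have "card P \<le> 2 * (card P - 1)" using assms(2) by simp
        then have "M * card P \<le> M * (2 * (card P - 1))" by (rule mult_le_mono2)
        then have n: "n \<le> M * (2 * (card P - 1))" using assms(3) by (rule le_trans[rotated])
        have "0 < M * (2 * (card P - 1))" using assms by auto
        with n have "n - 1 < M * (2 * (card P - 1))" by (cases n) simp_all
        then show ?thesis by (simp only: mult_ac)
      qed
      then show ?thesis using assms(4) by (simp add: less_mult_imp_div_less mult.commute)
    qed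
    ultimately show False using assms(2) by linarith
  qed
  then obtain p q where pq: "p \<in> P" "q \<in> P" "p \<noteq> q" "?g p = ?g q" unfolding inj_on_def by blast
  have d: "a \<le> b + 2 * M" if "a div (2 * M) = b div (2 * M)" for a b :: nat
  proof -
    have "a \<le> 2 * M + 2 * M * (a div (2 * M))"
      using dividend_less_times_div[of "2 * M" a] assms(4) by simp
    also have "\<dots> = 2 * M + 2 * M * (b div (2 * M))" using that by simp
    also have "\<dots> \<le> 2 * M + b" by (intro add_left_mono times_div_less_eq_dividend)
    finally show ?thesis by simp
  qed
  have "f p \<ge> 1" "f q \<ge> 1" using assms(1) pq by auto
  then show ?thesis using d[OF pq(4)] d[OF pq(4)[symmetric]] pq by (intro bexI[of _ p] bexI[of _ q]) auto
qed

text \<open>The pigeonhole argument controls only one coordinate. It is applied to the one in which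
  the direction \<open>(u, v)\<close> is larger in absolute value; the other difference is then no
  larger.\<close>

lemma oblique_trace_close_pair:
  assumes L: "affine L" "aff_dim L = 1"
    and P: "2 \<le> card (grid_trace n L)" "n \<le> M * card (grid_trace n L)" "1 \<le> M"
  shows "\<exists>p\<in>grid_trace n L. \<exists>q\<in>grid_trace n L. p \<noteq> q \<and>
    \<bar>int (fst p) - int (fst q)\<bar> \<le> 2 * int M \<and> \<bar>int (snd p) - int (snd q)\<bar> \<le> 2 * int M"
proof -
  let ?r = "\<lambda>p :: nat \<times> nat. (real (fst p), real (snd p))"
  have rinj: "?r p \<noteq> ?r q" if "p \<noteq> q" for p q using that by (auto simp: prod_eq_iff)
  obtain p0 q0 where pq0: "p0 \<in> grid_trace n L" "q0 \<in> grid_trace n L" "p0 \<noteq> q0"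
  proof -
    have "finite (grid_trace n L)" using P(1) by (intro card_ge_0_finite) simp
    then have "\<not> (\<forall>p\<in>grid_trace n L. \<forall>q\<in>grid_trace n L. p = q)" using P(1) card_le_Suc0_iff_eq by force
    then show ?thesis using that by blast
  qed
  define u v where "u = real (fst q0) - real (fst p0)" and "v = real (snd q0) - real (snd p0)"
  have Lp: "L = {?r p0 + t *\<^sub>R (?r q0 - ?r p0) | t. True}"
    using pq0 rinj[OF pq0(3)] by (intro affine_line_parametrization[OF L]) (simp_all add: grid_trace_def)
  have mem: "\<exists>t. z = ?r p0 + t *\<^sub>R (?r q0 - ?r p0)" if "z \<in> L" for z
    using that by (subst (asm) Lp) blast
  have par: "(real (fst p) - real (fst q)) * v = (real (snd p) - real (snd q)) * u"
    if "p \<in> grid_trace n L" "q \<in> grid_trace n L" for p q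
  proof -
    have "?r p \<in> L" "?r q \<in> L" using that unfolding grid_trace_def by auto
    then obtain s t where "?r p = ?r p0 + s *\<^sub>R (?r q0 - ?r p0)" "?r q = ?r p0 + t *\<^sub>R (?r q0 - ?r p0)"
      using mem[of "?r p"] mem[of "?r q"] by blast
    then have "real (fst p) = real (fst p0) + s * u" "real (snd p) = real (snd p0) + s * v"
      "real (fst q) = real (fst p0) + t * u" "real (snd q) = real (snd p0) + t * v"
      unfolding u_def v_def by auto
    then show ?thesis by (simp add: algebra_simps)
  qed
  have uv: "u \<noteq> 0 \<or> v \<noteq> 0" using pq0(3) unfolding u_def v_def by (auto simp: prod_eq_iff)
  have ab: "\<bar>b\<bar> \<le> c" if "\<bar>a\<bar> \<le> c" "a * v = b * u" "\<bar>v\<bar> \<le> \<bar>u\<bar>" "u \<noteq> 0" for a b c u v :: real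
  proof -
    have "\<bar>b\<bar> * \<bar>u\<bar> = \<bar>a\<bar> * \<bar>v\<bar>" using that(2) by (metis abs_mult)
    also have "\<dots> \<le> c * \<bar>u\<bar>" using that by (intro mult_mono) auto
    finally show ?thesis using that(4) by simp
  qed
  have conv: "\<bar>int a - int b\<bar> \<le> 2 * int M \<longleftrightarrow> \<bar>real a - real b\<bar> \<le> 2 * real M" for a b by linarith
  show ?thesis
  proof (cases "\<bar>v\<bar> \<le> \<bar>u\<bar>")
    case True
    have "fst ` grid_trace n L \<subseteq> {1..n}" unfolding grid_trace_def by auto
    from pigeonhole_close_pair[OF this P] obtain p q where
      pq: "p \<in> grid_trace n L" "q \<in> grid_trace n L" "p \<noteq> q" "\<bar>int (fst p) - int (fst q)\<bar> \<le> 2 * int M" by blast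
    have "\<bar>real (snd p) - real (snd q)\<bar> \<le> 2 * real M"
      using ab[OF pq(4)[unfolded conv] par[OF pq(1,2)] True] uv True by auto
    then show ?thesis using pq unfolding conv by blast
  next
    case False
    have "snd ` grid_trace n L \<subseteq> {1..n}" unfolding grid_trace_def by auto
    from pigeonhole_close_pair[OF this P] obtain p q where
      pq: "p \<in> grid_trace n L" "q \<in> grid_trace n L" "p \<noteq> q" "\<bar>int (snd p) - int (snd q)\<bar> \<le> 2 * int M" by blast
    have "\<bar>real (fst p) - real (fst q)\<bar> \<le> 2 * real M"
      using ab[OF pq(4)[unfolded conv] par[OF pq(1,2), symmetric]] uv False by auto
    then show ?thesis using pq unfolding conv by blast
  qed
qed

text \<open>
  A line with many grid points has two of them at small distance, and their difference together
  with \<open>p\<close> determines the line.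
\<close>

lemma card_oblique_traces_through:
  assumes "1 \<le> M"
  shows "card {P \<in> oblique_traces n. p \<in> P \<and> n \<le> M * card P} \<le> 25 * M\<^sup>2"
proof -
  let ?K = "{P \<in> oblique_traces n. p \<in> P \<and> n \<le> M * card P}"
  let ?I = "{- 2 * int M..2 * int M}"
  let ?r = "\<lambda>p :: nat \<times> nat. (real (fst p), real (snd p))"
  let ?\<delta> = "\<lambda>d :: (nat \<times> nat) \<times> (nat \<times> nat). (int (fst (snd d)) - int (fst (fst d)), int (snd (snd d)) - int (snd (fst d)))"
  have "\<exists>d. fst d \<in> P \<and> snd d \<in> P \<and> fst d \<noteq> snd d \<and> ?\<delta> d \<in> ?I \<times> ?I" if P: "P \<in> ?K" for P
  proof -
    obtain L where L: "P = grid_trace n L" "affine L" "aff_dim L = 1"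
      using P unfolding oblique_traces_def grid_lines_def by auto
    obtain a b where "a \<in> P" "b \<in> P" "a \<noteq> b"
        "\<bar>int (fst a) - int (fst b)\<bar> \<le> 2 * int M" "\<bar>int (snd a) - int (snd b)\<bar> \<le> 2 * int M"
    proof -
      have "2 \<le> card (grid_trace n L)" "n \<le> M * card (grid_trace n L)"
        using P oblique_trace_inj(5)[of P n] unfolding L(1) by auto
      from oblique_trace_close_pair[OF L(2,3) this assms] show ?thesis using that unfolding L(1) by blast
    qed
    then show ?thesis by (intro exI[of _ "(a, b)"]) auto
  qed
  note ex = this
  \<comment> \<open>A chosen close pair on the line; its difference vector is the code of the line
    among those through \<open>p\<close>.\<close>
  define d where "d P = (SOME d. fst d \<in> P \<and> snd d \<in> P \<and> fst d \<noteq> snd d \<and> ?\<delta> d \<in> ?I \<times> ?I)" for P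
  have d: "fst (d P) \<in> P \<and> snd (d P) \<in> P \<and> fst (d P) \<noteq> snd (d P) \<and> ?\<delta> (d P) \<in> ?I \<times> ?I"
    if "P \<in> ?K" for P
    unfolding d_def by (rule someI_ex[OF ex[OF that]])
  have "inj_on (\<lambda>P. ?\<delta> (d P)) ?K"
  proof (rule inj_onI)
    fix P P' assume h: "P \<in> ?K" "P' \<in> ?K" "?\<delta> (d P) = ?\<delta> (d P')"
    obtain L where L: "P = grid_trace n L" "affine L" "aff_dim L = 1"
      using h unfolding oblique_traces_def grid_lines_def by auto
    obtain L' where L': "P' = grid_trace n L'" "affine L'" "aff_dim L' = 1"
      using h unfolding oblique_traces_def grid_lines_def by auto
    have e1: "L = {?r p + t *\<^sub>R (?r (snd (d P)) - ?r (fst (d P))) | t. True}"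
      using d[OF h(1)] h(1) L(1)
      by (intro affine_line_determined L) (auto simp: grid_trace_def prod_eq_iff)
    have e2: "L' = {?r p + t *\<^sub>R (?r (snd (d P')) - ?r (fst (d P'))) | t. True}"
      using d[OF h(2)] h(2) L'(1)
      by (intro affine_line_determined L') (auto simp: grid_trace_def prod_eq_iff)
    have "?r (snd (d P)) - ?r (fst (d P)) = ?r (snd (d P')) - ?r (fst (d P'))"
      using h(3) by (simp add: of_int_eq_iff[where 'a = real, symmetric] del: of_int_eq_iff)
    then have "L = L'" using e1 e2 by simp
    then show "P = P'" using L L' by simp
  qed
  moreover have "(\<lambda>P. ?\<delta> (d P)) ` ?K \<subseteq> ?I \<times> ?I" using d by blast
  ultimately have "card ?K \<le> card (?I \<times> ?I)" by (intro card_inj_on_le) auto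
  also have "\<dots> = (4 * M + 1) * (4 * M + 1)" 
  proof -
    have "card ?I = 4 * M + 1" by (simp add: nat_eq_iff)
    then show ?thesis by (simp only: card_cartesian_product)
  qed
  also have "\<dots> \<le> (5 * M) * (5 * M)" using assms by (intro mult_le_mono) auto
  finally show ?thesis by (simp add: power2_eq_square)
qed

lemma finite_oblique_traces: "finite (oblique_traces n)"
  by (rule finite_subset[of _ "Pow ({1..n} \<times> {1..n})"]) (use oblique_trace_inj(1) in auto)

section \<open>Numerical estimates and the refinement steps\<close>

text \<open>Group the factors into \<open>j\<close> blocks of length \<open>t div j\<close> and
  apply Bernoulli's inequality to each. For fixed \<open>j\<close> this bounds the exponential below
  by a polynomial of degree \<open>j\<close> in \<open>t div j\<close>.\<close>

lemma bernoulli_blocks: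
  fixes x :: real
  assumes "0 \<le> x"
  shows "(1 + x * real (t div j)) ^ j \<le> (1 + x) ^ t"
proof -
  have "(1 + x * real (t div j)) ^ j \<le> ((1 + x) ^ (t div j)) ^ j"
    using Bernoulli_inequality[of x "t div j"] assms by (intro power_mono) (auto simp: mult.commute)
  also have "\<dots> = (1 + x) ^ (t div j * j)" by (simp add: power_mult)
  also have "\<dots> \<le> (1 + x) ^ t" using assms by (intro power_increasing) auto
  finally show ?thesis .
qed

text \<open>Splits the threshold condition of \<open>random_bijection_step\<close>: each of the
  \<open>t\<close> factors leaves room for a gain \<open>y\<close>, and the gains together pay for
  \<open>Q\<close>.\<close>

lemma power_ratio_le:
  fixes A B y Q :: real
  assumes "0 \<le> A" "0 \<le> y" "A * y \<le> B" "Q \<le> y ^ t"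
  shows "A ^ t * Q \<le> B ^ t"
proof -
  have "A ^ t * Q \<le> A ^ t * y ^ t" using assms by (intro mult_left_mono) auto
  also have "\<dots> = (A * y) ^ t" by (simp add: power_mult_distrib)
  also have "\<dots> \<le> B ^ t" using assms by (intro power_mono) auto
  finally show ?thesis .
qed

text \<open>\<open>c ^ 4 \<le> b\<close> gives \<open>b ^ 3 \<le> (b / c) ^ 4\<close>, so four
  powers of \<open>b / c\<close> pay for three powers of \<open>b\<close>. The factor 800 is
  absorbed into one more power of \<open>b\<close>.\<close>

lemma power_beats_polynomial:
  fixes b c :: real
  assumes "1 < c" "c ^ 4 \<le> b" "800 \<le> b" "d + 1 \<le> 3 * i"
  shows "800 * b ^ d \<le> (b / c) ^ (4 * i)"
proof -
  have "b ^ 3 * c ^ 4 \<le> b ^ 3 * b" using assms by (intro mult_left_mono) auto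
  then have "b ^ 3 \<le> (b / c) ^ 4"
    using assms by (simp add: power_divide pos_le_divide_eq power_numeral_reduce mult_ac)
  then have "(b ^ 3) ^ i \<le> ((b / c) ^ 4) ^ i" using assms by (intro power_mono) auto
  then have 1: "b ^ (3 * i) \<le> (b / c) ^ (4 * i)" by (simp add: power_mult)
  have "800 * b ^ d \<le> b * b ^ d" using assms by (intro mult_right_mono) auto
  also have "\<dots> = b ^ (d + 1)" by simp
  also have "\<dots> \<le> b ^ (3 * i)" using assms by (intro power_increasing) auto
  finally show ?thesis using 1 by linarith
qed

section \<open>The invariant of a stage and its application to lines\<close>

text \<open>A row class and a column class are matched by carrying the same label.\<close>

definition balanced :: "nat \<Rightarrow> nat \<Rightarrow> (nat \<Rightarrow> nat) \<Rightarrow> (nat \<Rightarrow> nat) \<Rightarrow> bool" where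
  "balanced n m ca cb \<longleftrightarrow> cb ` {1..n} \<subseteq> ca ` {1..n} \<and>
    (\<forall>j\<in>ca ` {1..n}. card {y \<in> {1..n}. cb y = j} = card {x \<in> {1..n}. ca x = j} \<and>
      card {x \<in> {1..n}. ca x = j} \<in> {m, m + 1})"

text \<open>The test in the conditional is "weight at least \<open>1 / m\<^sup>2\<close>" cleared of
  denominators. \<open>e\<close> is the additive error: 0 for the trivial partition,
  \<open>b ^ 2\<close> after a stage ending at \<open>m = b ^ 3\<close>.\<close>

definition spread :: "nat \<Rightarrow> nat \<Rightarrow> nat \<Rightarrow> real \<Rightarrow> bool" where
  "spread n k m e \<longleftrightarrow> (\<exists>ca cb. balanced n m ca cb \<and> (\<forall>P\<in>oblique_traces n.
    real (card {p \<in> P. ca (fst p) = cb (snd p)}) \<le>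
      (if n \<le> m\<^sup>2 * card P then real m * (real (card P) / real n) + e else real k / 1000)))"

lemma oblique_step:
  fixes ca cb :: "nat \<Rightarrow> nat" and g :: "(nat \<times> nat) set \<Rightarrow> real"
  assumes n: "1 \<le> n" and m: "2 \<le> m" and e: "0 \<le> e" "e \<le> real m"
    and bal: "balanced n m ca cb"
    and sp: "\<And>P. P \<in> oblique_traces n \<Longrightarrow> n \<le> m\<^sup>2 * card P \<Longrightarrow>
      real (card {p \<in> P. ca (fst p) = cb (snd p)}) \<le> real m * (real (card P) / real n) + e"
    and R: "\<And>x. x \<in> {1..n} \<Longrightarrow> card {z \<in> {1..n}. R x z} \<le> r"
    and Rca: "\<And>x z. x \<in> {1..n} \<Longrightarrow> z \<in> {1..n} \<Longrightarrow> R x z \<Longrightarrow> ca x = ca z"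
    and thr: "\<And>P. P \<in> oblique_traces n \<Longrightarrow> n \<le> m\<^sup>2 * card P \<Longrightarrow> \<exists>t. t < m \<and> real t < g P \<and>
      ((real m * (real (card P) / real n) + e) * real r) ^ t * (800 * real m ^ 7)
        \<le> ((g P - real t) * (real m - real t)) ^ t"
  shows "\<exists>\<phi>. bij_betw \<phi> {1..n} {1..n} \<and> (\<forall>y\<in>{1..n}. ca (\<phi> y) = cb y) \<and>
    (\<forall>P\<in>oblique_traces n. n \<le> m\<^sup>2 * card P \<longrightarrow> real (card {p \<in> P. R (fst p) (\<phi> (snd p))}) \<le> g P)"
proof -
  define A where "A = {P \<in> oblique_traces n. n \<le> m\<^sup>2 * card P}"
  \<comment> \<open>The least integer above \<open>g P\<close>, so that a count below
    \<open>a P\<close> is at most \<open>g P\<close>.\<close>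
  define a where "a P = nat \<lfloor>g P\<rfloor> + 1" for P
  have g: "0 \<le> g P" "g P < real (a P)" "\<And>c. c < a P \<Longrightarrow> real c \<le> g P" if P: "P \<in> A" for P
  proof -
    show g0: "0 \<le> g P" using thr[of P] P unfolding A_def by force
    show "g P < real (a P)" unfolding a_def using g0 by linarith
    show "real c \<le> g P" if "c < a P" for c using that g0 unfolding a_def by linarith
  qed
  have w: "real (card P) / real n \<le> 1" if "P \<in> oblique_traces n" for P
    using oblique_trace_inj(4)[OF that] n by simp
  have sz: "card {y \<in> {1..n}. cb y = j} = card {x \<in> {1..n}. ca x = j}
      \<and> m \<le> card {x \<in> {1..n}. ca x = j} \<and> card {x \<in> {1..n}. ca x = j} \<le> m + 1" if "j \<in> ca ` {1..n}" for j
    using bal that unfolding balanced_def by auto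
  have "\<exists>\<phi>. bij_betw \<phi> {1..n} {1..n} \<and> (\<forall>y\<in>{1..n}. ca (\<phi> y) = cb y) \<and>
    (\<forall>P\<in>A. card {p \<in> P. R (fst p) (\<phi> (snd p))} < a P)"
  \<comment> \<open>A heavy line keeps at most \<open>m + e \<le> 2 * m\<close> points, which gives
    \<open>D\<close>; \<open>H\<close> is the count of heavy lines through a point with
    \<open>M = m\<^sup>2\<close>. Bounding \<open>m + 1\<close> by \<open>2 * m\<close>, the
    requirement on \<open>Q\<close> is at most \<open>600 * m ^ 7\<close>.\<close>
  proof (rule random_bijection_step[where D = "2 * m" and H = "25 * m ^ 4" and Q = "800 * real m ^ 7" and r = r and m = m])
    show "cb ` {1..n} \<subseteq> ca ` {1..n}" using bal unfolding balanced_def by auto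
    show "P \<subseteq> {1..n} \<times> {1..n} \<and> inj_on snd P" if "P \<in> A" for P
      using that oblique_trace_inj unfolding A_def by blast
    show "card {p \<in> P. ca (fst p) = cb (snd p)} \<le> 2 * m" if "P \<in> A" for P
    proof -
      have P: "P \<in> oblique_traces n" "n \<le> m\<^sup>2 * card P" using that unfolding A_def by auto
      have "real (card {p \<in> P. ca (fst p) = cb (snd p)}) \<le> real m * (real (card P) / real n) + e" by (rule sp[OF P])
      also have "\<dots> \<le> real m * 1 + real m" using w[OF P(1)] e by (intro add_mono mult_left_mono) auto
      finally show ?thesis by linarith
    qed
    show "card {P \<in> A. p \<in> P} \<le> 25 * m ^ 4" for p
    proof -
      have "{P \<in> A. p \<in> P} = {P \<in> oblique_traces n. p \<in> P \<and> n \<le> m\<^sup>2 * card P}" unfolding A_def by auto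
      then show ?thesis using card_oblique_traces_through[of "m\<^sup>2" n p] m by (simp flip: power_mult)
    qed
    have "(real m + 1)\<^sup>2 \<le> (2 * real m)\<^sup>2" using m by (intro power_mono) auto
    then have "3 * (real m + 1)\<^sup>2 * real (25 * m ^ 4) * real (2 * m) \<le> 3 * (2 * real m)\<^sup>2 * real (25 * m ^ 4) * real (2 * m)"
      by (intro mult_right_mono mult_left_mono) auto
    also have "\<dots> = 600 * real m ^ 7" by (simp add: power_mult_distrib eval_nat_numeral)
    also have "\<dots> \<le> 800 * real m ^ 7" by simp
    finally show "3 * (real m + 1)\<^sup>2 * real (25 * m ^ 4) * real (2 * m) \<le> 800 * real m ^ 7" .
    show "\<exists>t. t < m \<and> t < a P \<and> (real (card {p \<in> P. ca (fst p) = cb (snd p)}) * real r) ^ t * (800 * real m ^ 7)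
        \<le> ((real (a P) - real t) * (real m - real t)) ^ t" if PA: "P \<in> A" for P
    proof -
      have P: "P \<in> oblique_traces n" "n \<le> m\<^sup>2 * card P" using PA unfolding A_def by auto
      obtain t where t: "t < m" "real t < g P" and
        le: "((real m * (real (card P) / real n) + e) * real r) ^ t * (800 * real m ^ 7)
          \<le> ((g P - real t) * (real m - real t)) ^ t" using thr[OF P] by blast
      have "(real (card {p \<in> P. ca (fst p) = cb (snd p)}) * real r) ^ t * (800 * real m ^ 7)
          \<le> ((real m * (real (card P) / real n) + e) * real r) ^ t * (800 * real m ^ 7)"
        using sp[OF P] by (intro mult_right_mono power_mono) auto
      also note le
      also have "((g P - real t) * (real m - real t)) ^ t \<le> ((real (a P) - real t) * (real m - real t)) ^ t"
        using g(2)[OF PA] t by (intro power_mono mult_right_mono mult_nonneg_nonneg) auto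
      finally show ?thesis using t g(2)[OF PA] by (intro exI[of _ t]) auto
    qed
    show "finite A" unfolding A_def using finite_oblique_traces by auto
    show "0 < 800 * real m ^ 7" using m by simp
  qed (use m sz R Rca in \<open>simp_all only: finite_atLeastAtMost, linarith?\<close>)
  then show ?thesis using g(3) unfolding A_def by blast
qed

section \<open>Structures inside the column classes\<close>

text \<open>A class of size at least \<open>c * c\<close> has size \<open>q * c + r\<close> with
  \<open>r < c \<le> q\<close>, and this equals \<open>(q - r) * c + r * (c + 1)\<close>, a sum of
  blocks of the two permitted sizes.\<close>

lemma balanced_refinement_exists:
  fixes ca :: "'a \<Rightarrow> nat"
  assumes "finite X" "1 \<le> c" "\<And>x. x \<in> X \<Longrightarrow> c * c \<le> card {z \<in> X. ca z = ca x}"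
  shows "\<exists>ca' :: 'a \<Rightarrow> nat. (\<forall>x\<in>X. \<forall>z\<in>X. ca' x = ca' z \<longrightarrow> ca x = ca z) \<and>
    (\<forall>x\<in>X. card {z \<in> X. ca' z = ca' x} \<in> {c, c + 1})"
proof -
  define C where "C j = {z \<in> X. ca z = j}" for j
  define good where "good j g \<longleftrightarrow> (\<forall>x\<in>C j. card {z \<in> C j. g z = g x} \<in> {c, c + 1})" for j and g :: "'a \<Rightarrow> nat"
  have ex: "\<exists>g. good j g" for j
  proof (cases "C j = {}")
    case True then show ?thesis unfolding good_def by auto
  next
    case False
    then have s: "c * c \<le> card (C j)" using assms(3) unfolding C_def by auto
    let ?q = "card (C j) div c" and ?r = "card (C j) mod c"
    have c1: "c \<le> ?q" using assms(2) div_le_mono[OF s, of c] by simp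
    have c2: "?r < c" using assms(2) by simp
    have rq: "?r \<le> ?q" by (rule le_trans[OF less_imp_le[OF c2] c1])
    have "q * c + r = (q - r) * c + r * (c + 1)" if h: "r \<le> q" for q r :: nat
    proof -
      obtain d where "q = r + d" using le_Suc_ex[OF h] by blast
      then show ?thesis by (simp add: algebra_simps)
    qed
    from this[OF rq] have cC: "card (C j) = (?q - ?r) * c + ?r * (c + 1)" by (simp only: div_mult_mod_eq)
    have "finite (C j)" "0 < c" using assms(1,2) unfolding C_def by auto
    from balanced_coloring_exists[OF this(1) cC this(2)] show ?thesis unfolding good_def by simp
  qed
  define g where "g j = (SOME h. good j h)" for j
  have g: "good j (g j)" for j unfolding g_def by (rule someI_ex[OF ex])
  \<comment> \<open>The new label contains the old one, so new classes stay inside old ones;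
    \<open>prod_encode\<close> keeps labels natural numbers.\<close>
  define ca' where "ca' x = prod_encode (ca x, g (ca x) x)" for x
  have "card {z \<in> X. ca' z = ca' x} \<in> {c, c + 1}" if "x \<in> X" for x
  proof -
    have "{z \<in> X. ca' z = ca' x} = {z \<in> C (ca x). g (ca x) z = g (ca x) x}"
      unfolding ca'_def C_def by auto
    moreover have "x \<in> C (ca x)" using that unfolding C_def by auto
    ultimately show ?thesis using g[of "ca x"] unfolding good_def by auto
  qed
  then show ?thesis by (intro exI[of _ ca']) (auto simp: ca'_def)
qed

lemma regular_refinement_exists:
  fixes ca :: "'a \<Rightarrow> 'j"
  assumes "finite X" "\<And>x. x \<in> X \<Longrightarrow> k \<le> card {z \<in> X. ca z = ca x}"
  shows "\<exists>R. (\<forall>x z. R x z \<longrightarrow> ca x = ca z) \<and>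
    (\<forall>x\<in>X. card {z \<in> X. R x z} = k) \<and> (\<forall>z\<in>X. card {x \<in> X. R x z} = k)"
proof -
  define C where "C j = {z \<in> X. ca z = j}" for j
  define good where "good j Q \<longleftrightarrow> (\<forall>x\<in>C j. card {z \<in> C j. Q x z} = k) \<and> (\<forall>z\<in>C j. card {x \<in> C j. Q x z} = k)"
    for j and Q :: "'a \<Rightarrow> 'a \<Rightarrow> bool"
  have ex: "\<exists>Q. good j Q" for j
  proof (cases "C j = {}")
    case True then show ?thesis unfolding good_def by auto
  next
    case False
    then have "k \<le> card (C j)" using assms(2) unfolding C_def by auto
    moreover have "finite (C j)" using assms(1) unfolding C_def by auto
    ultimately show ?thesis unfolding good_def using regular_relation_exists by blast
  qed
  define Q where "Q j = (SOME Q. good j Q)" for j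
  have Q: "good j (Q j)" for j unfolding Q_def by (rule someI_ex[OF ex])
  define R where "R x z \<longleftrightarrow> ca x = ca z \<and> Q (ca x) x z" for x z
  have "card {z \<in> X. R x z} = k" if "x \<in> X" for x
  proof -
    have "{z \<in> X. R x z} = {z \<in> C (ca x). Q (ca x) x z}" unfolding R_def C_def by auto
    then show ?thesis using Q[of "ca x"] that unfolding good_def C_def by auto
  qed
  moreover have "card {x \<in> X. R x z} = k" if "z \<in> X" for z
  proof -
    have "{x \<in> X. R x z} = {x \<in> C (ca z). Q (ca z) x z}" unfolding R_def C_def by auto
    then show ?thesis using Q[of "ca z"] that unfolding good_def C_def by auto
  qed
  moreover have "\<forall>x z. R x z \<longrightarrow> ca x = ca z" unfolding R_def by blast
  ultimately show ?thesis by blast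
qed

section \<open>The gain per factor in the three cases\<close>

text \<open>As \<open>e \<le> M / b ^ 4\<close>, the product without the gain is at most
  \<open>M * (b ^ 3 * w + 3)\<close>, and the gain adds about \<open>M * b\<^sup>2 / 8\<close>. On
  the right \<open>T\<close> takes at most a quarter of the slack \<open>b\<^sup>2\<close>, and
  replacing \<open>M\<close> by \<open>M - T\<close> costs at most another \<open>M\<close> because
  \<open>b ^ 6 / 2 \<le> M\<close>.\<close>

lemma large_line_step:
  fixes b M w e T :: real
  assumes b: "10 ^ 36 \<le> b" and w: "0 \<le> w" "w \<le> 1" and M: "b ^ 12 \<le> M"
    and e: "0 \<le> e" "e * b ^ 4 \<le> M" and T: "0 \<le> T" "T \<le> b\<^sup>2 / 4"
  shows "(M * w + e) * (b ^ 3 + 1) * (1 + 1 / (8 * b)) \<le> (b ^ 3 * w + b\<^sup>2 - T) * (M - T)"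
proof -
  have b1: "1 \<le> b" "0 < b" "100 \<le> b" using b by auto
  have Mp: "0 < M" using M b1 by (meson less_le_trans zero_less_power)
  have sq: "100 * b \<le> b\<^sup>2" using b1 by (simp add: power2_eq_square)
  have bb: "b \<le> b\<^sup>2" "10000 \<le> b\<^sup>2" using sq b1 by linarith+
  have "e \<le> M / b ^ 4" using e b1 by (simp add: field_simps)
  then have "M * w + e \<le> M * (w + 1 / b ^ 4)" by (simp add: algebra_simps)
  then have "(M * w + e) * ((b ^ 3 + 1) * (1 + 1 / (8 * b))) \<le> M * (w + 1 / b ^ 4) * ((b ^ 3 + 1) * (1 + 1 / (8 * b)))"
    using b1 by (intro mult_right_mono) auto
  also have "\<dots> = M * ((w + 1 / b ^ 4) * (b ^ 3 + 1) * (1 + 1 / (8 * b)))" by (simp only: mult.assoc)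
  also have "\<dots> \<le> M * (b ^ 3 * w + 3 / 4 * b\<^sup>2 - 1)"
  proof -
    have "(w + 1 / b ^ 4) * (b ^ 3 + 1) = b ^ 3 * w + w + 1 / b + 1 / b ^ 4"
      using b1 by (simp add: field_simps eval_nat_numeral)
    also have "\<dots> \<le> b ^ 3 * w + 3"
    proof -
      have "1 / b \<le> 1" "1 / b ^ 4 \<le> 1" using b1 by (simp_all add: one_le_power)
      then show ?thesis using w by linarith
    qed
    finally have "(w + 1 / b ^ 4) * (b ^ 3 + 1) * (1 + 1 / (8 * b)) \<le> (b ^ 3 * w + 3) * (1 + 1 / (8 * b))"
      using b1 by (intro mult_right_mono) auto
    also have "\<dots> = b ^ 3 * w + 3 + b\<^sup>2 * w / 8 + 3 / (8 * b)"
      using b1 by (simp add: field_simps eval_nat_numeral)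
    also have "\<dots> \<le> b ^ 3 * w + 3 / 4 * b\<^sup>2 - 1"
    proof -
      have "b\<^sup>2 * w \<le> b\<^sup>2" using w b1 by (simp add: mult_left_le)
      moreover have "3 / (8 * b) \<le> 1" using b1 by simp
      ultimately show ?thesis using bb by linarith
    qed
    finally show ?thesis using Mp by (intro mult_left_mono) auto
  qed
  also have "\<dots> \<le> (b ^ 3 * w + b\<^sup>2 - T) * (M - T)"
  proof -
    let ?u = "b ^ 3 * w"
    have u: "0 \<le> ?u" "?u \<le> b ^ 3" using w b1 by (auto simp: mult_left_le)
    have TM: "b\<^sup>2 / 4 \<le> M"
    proof -
      have "b\<^sup>2 \<le> b ^ 12" using b1 by (intro power_increasing) auto
      then show ?thesis using M bb by linarith
    qed
    have c: "b ^ 3 \<le> b ^ 4" "b ^ 2 \<le> b ^ 4" using b1 by (auto intro: power_increasing)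
    have "(?u + 3 / 4 * b\<^sup>2) * (b\<^sup>2 / 4) \<le> (2 * b ^ 4) * (b\<^sup>2 / 4)"
    proof (rule mult_right_mono)
      have "3 / 4 * b\<^sup>2 \<le> b ^ 4" using c(2) zero_le_power2[of b] by linarith
      then show "?u + 3 / 4 * b\<^sup>2 \<le> 2 * b ^ 4" using u(2) c(1) by linarith
    qed simp
    also have "\<dots> = b ^ 6 / 2" by (simp add: eval_nat_numeral)
    also have "\<dots> \<le> M"
    proof -
      have "b ^ 6 \<le> b ^ 12" using b1 by (intro power_increasing) auto
      moreover have "0 \<le> b ^ 6" using b1 by simp
      ultimately show ?thesis using M by linarith
    qed
    finally have prod: "(?u + 3 / 4 * b\<^sup>2) * (b\<^sup>2 / 4) \<le> M" .
    have "M * (a - 1) \<le> a * (M - c)" if "a * c \<le> M" for a c using that by (simp add: algebra_simps)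
    from this[OF prod] have "M * (?u + 3 / 4 * b\<^sup>2 - 1) \<le> (?u + 3 / 4 * b\<^sup>2) * (M - b\<^sup>2 / 4)" .
    also have "\<dots> \<le> (?u + b\<^sup>2 - T) * (M - T)"
      using u T TM b1 by (intro mult_mono) auto
    finally show ?thesis .
  qed
  finally show ?thesis by (simp only: mult.assoc)
qed

text \<open>For such light lines \<open>M * w + e \<le> 2 * M / b ^ 4\<close>, so the expected
  number of kept points is of order \<open>1 / b\<close>. Each factor can therefore gain
  \<open>b / 20000\<close>, and the fixed subset size 500 is enough.\<close>

lemma small_line_step:
  fixes b M w e g :: real
  assumes b: "10 ^ 36 \<le> b" and w: "w * b ^ 6 \<le> 1" and M: "b ^ 12 \<le> M"
    and e: "e * b ^ 4 \<le> M" and g: "501 \<le> g"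
  shows "(M * w + e) * (b ^ 3 + 1) * (b / 20000) \<le> (g - 500) * (M - 500)"
proof -
  have b1: "1 \<le> b" "0 < b" "1000 \<le> b" using b by auto
  have "b \<le> b ^ 12" using b1 power_increasing[of 1 12 b] by simp
  then have M1: "1000 \<le> M" using M b1 by linarith
  have "w \<le> 1 / b ^ 6" using w b1 by (simp add: field_simps)
  also have "\<dots> \<le> 1 / b ^ 4" using b1 by (intro divide_left_mono power_increasing) auto
  finally have "M * w \<le> M * (1 / b ^ 4)" using M1 by (intro mult_left_mono) auto
  moreover have "e \<le> M * (1 / b ^ 4)" using e b1 by (simp add: field_simps)
  ultimately have "M * w + e \<le> M * (1 / b ^ 4) + M * (1 / b ^ 4)" by (rule add_mono)
  then have "M * w + e \<le> 2 * M / b ^ 4" by simp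
  then have "(M * w + e) * ((b ^ 3 + 1) * (b / 20000)) \<le> (2 * M / b ^ 4) * ((2 * b ^ 3) * (b / 20000))"
  proof (rule mult_mono)
    show "(b ^ 3 + 1) * (b / 20000) \<le> (2 * b ^ 3) * (b / 20000)"
      using b1 one_le_power[of b 3] by (intro mult_right_mono) auto
  qed (use b1 M1 in auto)
  also have "\<dots> = M / 5000" using b1 by (simp add: field_simps eval_nat_numeral)
  also have "\<dots> \<le> M - 500" using M1 by linarith
  also have "\<dots> \<le> (g - 500) * (M - 500)" using g M1 by simp
  finally show ?thesis by (simp only: mult.assoc)
qed

text \<open>Here \<open>(M * w + e) * k \<le> M * (k * w + 1)\<close>. After subtracting
  \<open>T\<close>, the slack \<open>k / 100\<close> is still at least \<open>9 * k / 1000\<close>,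
  which covers the gain of at most \<open>k / 200\<close>, the term 1 and the loss of
  \<open>M / 1000\<close>.\<close>

lemma final_line_step:
  fixes k M w e T :: real
  assumes k: "10 ^ 36 \<le> k" and w: "0 \<le> w" "w \<le> 1" and M: "k \<le> M" and e: "0 \<le> e" "e * k \<le> M"
    and T: "0 \<le> T" "T \<le> k / 1000"
  shows "(M * w + e) * k * (1 + 1 / 200) \<le> (k * (w + 1 / 100) - T) * (M - T)"
proof -
  have k1: "10 ^ 6 \<le> k" "0 < k" using k by auto
  have Mp: "0 < M" using M k1 by linarith
  have kw: "0 \<le> k * w" "k * w \<le> k" using w k1 by (auto simp: mult_left_le)
  have "(M * w + e) * k * (1 + 1 / 200) = (M * (k * w) + e * k) * (1 + 1 / 200)" by (simp add: algebra_simps)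
  also have "\<dots> \<le> (M * (k * w) + M) * (1 + 1 / 200)" using e by (intro mult_right_mono) auto
  also have "\<dots> = M * ((k * w + 1) * (1 + 1 / 200))" by (simp add: algebra_simps)
  also have "\<dots> \<le> M * ((k * w + 9 / 1000 * k) * (999 / 1000))"
  proof (rule mult_left_mono)
    have "(a + 1) * (1 + 1 / 200) \<le> (a + 9 / 1000 * k) * (999 / 1000)" if "a \<le> k" for a
      using that k1 by (simp add: algebra_simps)
    then show "(k * w + 1) * (1 + 1 / 200) \<le> (k * w + 9 / 1000 * k) * (999 / 1000)" using kw(2) .
  qed (use Mp in simp)
  also have "\<dots> = (k * w + 9 / 1000 * k) * (M * (999 / 1000))" by simp
  also have "\<dots> \<le> (k * (w + 1 / 100) - T) * (M - T)"
    using kw k1 Mp M T by (intro mult_mono) (auto simp: algebra_simps)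
  finally show ?thesis .
qed

section \<open>The stages and their iteration\<close>

text \<open>The lower bound on \<open>m\<close> makes the rounding and the old error negligible, the
  upper bound keeps \<open>800 * m ^ 7\<close> polynomial in \<open>b\<close>. The range up to
  \<open>b ^ 48\<close> is for the first stage, whose starting value \<open>n\<close> is
  arbitrary.\<close>

lemma spread_step:
  assumes k: "10 ^ 36 \<le> k" and b: "k \<le> b" and n: "1 \<le> n"
    and sp: "spread n k m e" and m: "b ^ 12 \<le> m" "m \<le> b ^ 48"
    and e: "0 \<le> e" "e * real b ^ 4 \<le> real m"
  shows "spread n k (b ^ 3) (real b ^ 2)"
proof -
  have rb: "10 ^ 36 \<le> real b" using k b by (metis le_trans numeral_power_le_of_nat_cancel_iff)
  have rk: "10 ^ 36 \<le> real k" using k by (metis numeral_power_le_of_nat_cancel_iff)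
  have b1: "1 \<le> b" "1 < b" using rb by (cases b; simp)+
  have rb1: "1 \<le> real b" using b1 by simp
  have b1000: "1000 \<le> b" using rb by simp
  have rm: "real b ^ 12 \<le> real m" using m by (metis of_nat_le_iff of_nat_power)
  have bm: "b \<le> m" using m(1) b1 self_le_power[of b 12] by linarith
  obtain ca cb where bal: "balanced n m ca cb" and
    cnt: "\<And>P. P \<in> oblique_traces n \<Longrightarrow> real (card {p \<in> P. ca (fst p) = cb (snd p)}) \<le>
      (if n \<le> m\<^sup>2 * card P then real m * (real (card P) / real n) + e else real k / 1000)"
    using sp unfolding spread_def by blast
  let ?X = "{1..n}"
  have csz: "card {z \<in> ?X. ca z = ca x} \<in> {m, m + 1}" if "x \<in> ?X" for x
    using bal that unfolding balanced_def by blast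
  have bb: "b ^ 3 * b ^ 3 \<le> m"
  proof -
    have "b ^ 3 * b ^ 3 = b ^ 6" by (simp flip: power_add)
    also have "\<dots> \<le> b ^ 12" using b1 by (intro power_increasing) auto
    finally show ?thesis using m by linarith
  qed
  obtain ca' :: "nat \<Rightarrow> nat" where ca': "\<And>x z. x \<in> ?X \<Longrightarrow> z \<in> ?X \<Longrightarrow> ca' x = ca' z \<Longrightarrow> ca x = ca z"
      "\<And>x. x \<in> ?X \<Longrightarrow> card {z \<in> ?X. ca' z = ca' x} \<in> {b ^ 3, b ^ 3 + 1}"
  proof -
    have big: "b ^ 3 * b ^ 3 \<le> card {z \<in> ?X. ca z = ca x}" if "x \<in> ?X" for x
      using csz[OF that] bb by force
    have "1 \<le> b ^ 3" using b1 by simp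
    from balanced_refinement_exists[OF finite_atLeastAtMost this big] show ?thesis using that by blast
  qed
  define g where "g P = (if n \<le> (b ^ 3)\<^sup>2 * card P then real (b ^ 3) * (real (card P) / real n) + real b ^ 2
    else real k / 1000)" for P :: "(nat \<times> nat) set"
  have eb: "e \<le> real m"
  proof -
    have "e * 1 \<le> e * real b ^ 4" using e rb1 by (intro mult_left_mono one_le_power) auto
    then show ?thesis using e by linarith
  qed
  \<comment> \<open>The exponent 500 serves both cases below: as the number of Bernoulli blocks for
    heavy lines and as the subset size for light ones.\<close>
  have Q: "800 * real m ^ 7 \<le> (real b / 20000) ^ 500"
  proof -
    have "real m \<le> real b ^ 48" using m(2) by (metis of_nat_le_iff of_nat_power)
    then have "800 * real m ^ 7 \<le> 800 * (real b ^ 48) ^ 7" by (intro mult_left_mono power_mono) auto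
    also have "\<dots> = 800 * real b ^ 336" by (simp flip: power_mult)
    also have "\<dots> \<le> (real b / 20000) ^ (4 * 125)" using rb by (intro power_beats_polynomial) auto
    finally show ?thesis by simp
  qed
  have thr: "\<exists>t. t < m \<and> real t < g P \<and>
      ((real m * (real (card P) / real n) + e) * real (b ^ 3 + 1)) ^ t * (800 * real m ^ 7)
        \<le> ((g P - real t) * (real m - real t)) ^ t"
    if P: "P \<in> oblique_traces n" "n \<le> m\<^sup>2 * card P" for P
  proof -
    let ?w = "real (card P) / real n"
    have w: "0 \<le> ?w" "?w \<le> 1" using oblique_trace_inj(4)[OF P(1)] n by auto
    show ?thesis
    proof (cases "n \<le> (b ^ 3)\<^sup>2 * card P")
      case True
      \<comment> \<open>The subset size is a quarter of the slack \<open>b ^ 2\<close>; it is this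
        large because each factor gains only \<open>1 + 1 / (8 * b)\<close>.\<close>
      let ?t = "b\<^sup>2 div 4"
      have tb: "real ?t \<le> real b ^ 2 / 4" using of_nat_div_le_of_nat[of "b\<^sup>2" 4, where 'a = real] by simp
      have t1: "?t < m"
      proof -
        have "?t < b\<^sup>2" using b1 by (intro div_less_dividend) auto
        also have "b\<^sup>2 \<le> b ^ 12" using b1 by (intro power_increasing) auto
        finally show ?thesis using m by linarith
      qed
      have gP: "g P = real b ^ 3 * ?w + real b ^ 2" unfolding g_def using True by simp
      have t2: "real ?t < g P"
      proof -
        have "0 \<le> real b ^ 3 * ?w" using w by simp
        moreover have "0 < real b ^ 2" using rb1 by simp
        ultimately show ?thesis unfolding gP using tb by linarith
      qed
      \<comment> \<open>In 500 blocks of \<open>b\<^sup>2 div 2000\<close> factors, Bernoulli gives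
        at least \<open>1 + b / 16000 - 1 / (8 * b) \<ge> b / 20000\<close> per block, matching
        \<open>Q\<close>.\<close>
      have y: "800 * real m ^ 7 \<le> (1 + 1 / (8 * real b)) ^ ?t"
      proof -
        have "real (b\<^sup>2) / 2000 - 1 \<le> real (b\<^sup>2 div 2000)"
        proof -
          have "b\<^sup>2 = 2000 * (b\<^sup>2 div 2000) + b\<^sup>2 mod 2000" "b\<^sup>2 mod 2000 < 2000" by simp_all
          then show ?thesis by linarith
        qed
        moreover have "?t div 500 = b\<^sup>2 div 2000" by (simp add: div_mult2_eq[symmetric])
        ultimately have s: "real b ^ 2 / 2000 - 1 \<le> real (?t div 500)" by simp
        have "real b / 20000 \<le> 1 + 1 / (8 * real b) * (real b ^ 2 / 2000 - 1)"
        proof -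
          have eq: "1 + 1 / (8 * real b) * (real b ^ 2 / 2000 - 1) = 1 + real b / 16000 - 1 / (8 * real b)"
            using rb1 by (simp add: field_simps power2_eq_square)
          have le: "real b / 20000 \<le> 1 + real b / 16000 - c" if "c \<le> 1" for c using that rb1 by simp
          have "1 / (8 * real b) \<le> 1" using rb1 by simp
          from le[OF this] show ?thesis unfolding eq .
        qed
        also have "\<dots> \<le> 1 + 1 / (8 * real b) * real (?t div 500)"
          using s rb1 by (intro add_left_mono mult_left_mono) auto
        finally have "(real b / 20000) ^ 500 \<le> (1 + 1 / (8 * real b) * real (?t div 500)) ^ 500"
          using rb1 by (intro power_mono) auto
        also have "\<dots> \<le> (1 + 1 / (8 * real b)) ^ ?t" using rb1 by (intro bernoulli_blocks) auto
        finally show ?thesis using Q by linarith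
      qed
      have "((real m * ?w + e) * real (b ^ 3 + 1)) ^ ?t * (800 * real m ^ 7)
          \<le> ((g P - real ?t) * (real m - real ?t)) ^ ?t"
      proof (rule power_ratio_le[OF _ _ _ y])
        show "(real m * ?w + e) * real (b ^ 3 + 1) * (1 + 1 / (8 * real b)) \<le> (g P - real ?t) * (real m - real ?t)"
          using large_line_step[OF rb w rm e, of "real ?t"] tb unfolding gP by (simp add: add_ac)
      qed (use w e rb1 in auto)
      then show ?thesis using t1 t2 by blast
    next
      case False
      have gP: "g P = real k / 1000" unfolding g_def using False by simp
      have g501: "501 \<le> g P" unfolding gP using rk by simp
      have "real (card P * b ^ 6) \<le> real n" using False by (subst of_nat_le_iff) (simp add: mult.commute flip: power_mult)
      then have w6: "?w * real b ^ 6 \<le> 1" using n by (simp add: field_simps)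
      have "((real m * ?w + e) * real (b ^ 3 + 1)) ^ 500 * (800 * real m ^ 7)
          \<le> ((g P - real 500) * (real m - real 500)) ^ 500"
      proof (rule power_ratio_le[OF _ _ _ Q])
        show "(real m * ?w + e) * real (b ^ 3 + 1) * (real b / 20000) \<le> (g P - real 500) * (real m - real 500)"
          using small_line_step[OF rb w6 rm e(2) g501] by (simp add: add_ac)
      qed (use w e rb1 in auto)
      moreover have "real 500 < g P" using g501 by simp
      moreover have "500 < m" using b1000 bm by linarith
      ultimately show ?thesis by blast
    qed
  qed
  have "\<exists>\<phi>. bij_betw \<phi> ?X ?X \<and> (\<forall>y\<in>?X. ca (\<phi> y) = cb y) \<and>
    (\<forall>P\<in>oblique_traces n. n \<le> m\<^sup>2 * card P \<longrightarrow> real (card {p \<in> P. ca' (fst p) = ca' (\<phi> (snd p))}) \<le> g P)"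
  proof (rule oblique_step[OF n _ e(1) eb bal _ _ _ thr])
    show "2 \<le> m" using b1000 bm by linarith
    show "real (card {p \<in> P. ca (fst p) = cb (snd p)}) \<le> real m * (real (card P) / real n) + e"
      if "P \<in> oblique_traces n" "n \<le> m\<^sup>2 * card P" for P using cnt[OF that(1)] that(2) by simp
    show "card {z \<in> ?X. ca' x = ca' z} \<le> b ^ 3 + 1" if "x \<in> ?X" for x
    proof -
      have "{z \<in> ?X. ca' x = ca' z} = {z \<in> ?X. ca' z = ca' x}" by auto
      then show ?thesis using ca'(2)[OF that] by auto
    qed
    show "ca x = ca z" if "x \<in> ?X" "z \<in> ?X" "ca' x = ca' z" for x z by (rule ca'(1)[OF that])
  qed
  then obtain \<phi> where \<phi>: "bij_betw \<phi> ?X ?X" "\<And>y. y \<in> ?X \<Longrightarrow> ca (\<phi> y) = cb y"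
    and \<phi>g: "\<And>P. P \<in> oblique_traces n \<Longrightarrow> n \<le> m\<^sup>2 * card P \<Longrightarrow>
      real (card {p \<in> P. ca' (fst p) = ca' (\<phi> (snd p))}) \<le> g P" by blast
  \<comment> \<open>A row inherits the new label of the column to which \<open>\<phi>\<close> sends
    it.\<close>
  have "balanced n (b ^ 3) ca' (ca' \<circ> \<phi>)"
    unfolding balanced_def
  proof (intro conjI ballI)
    show "(ca' \<circ> \<phi>) ` ?X \<subseteq> ca' ` ?X" using \<phi>(1) by (auto simp: bij_betw_def)
    fix j assume "j \<in> ca' ` ?X"
    then obtain x where x: "x \<in> ?X" "j = ca' x" by blast
    show "card {x \<in> ?X. ca' x = j} \<in> {b ^ 3, b ^ 3 + 1}" using ca'(2)[OF x(1)] unfolding x(2) .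
    show "card {y \<in> ?X. (ca' \<circ> \<phi>) y = j} = card {x \<in> ?X. ca' x = j}"
    proof (rule bij_betw_same_card[of \<phi>])
      have "\<phi> ` {y \<in> ?X. (ca' \<circ> \<phi>) y = j} = {x \<in> \<phi> ` ?X. ca' x = j}" by auto
      then show "bij_betw \<phi> {y \<in> ?X. (ca' \<circ> \<phi>) y = j} {x \<in> ?X. ca' x = j}"
        using \<phi>(1) unfolding bij_betw_def by (auto intro: inj_on_subset)
    qed
  qed
  moreover have "real (card {p \<in> P. ca' (fst p) = (ca' \<circ> \<phi>) (snd p)}) \<le> g P" if P: "P \<in> oblique_traces n" for P
  proof (cases "n \<le> m\<^sup>2 * card P")
    case True then show ?thesis using \<phi>g[OF P] by simp
  next
    \<comment> \<open>A line light for \<open>m\<close> is light for \<open>b ^ 3 \<le> m\<close>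
      too. Its old bound \<open>k / 1000\<close> persists, since the new matching keeps a subset of
      the old points.\<close>
    case False
    have "(b ^ 3)\<^sup>2 * card P \<le> m\<^sup>2 * card P"
    proof -
      have "b ^ 3 \<le> b ^ 3 * b ^ 3" using b1 by simp
      then have "b ^ 3 \<le> m" using bb by linarith
      then show ?thesis by (intro mult_le_mono1 power_mono) auto
    qed
    then have "\<not> n \<le> (b ^ 3)\<^sup>2 * card P" using False by linarith
    then have gP: "g P = real k / 1000" unfolding g_def by (rule if_not_P)
    have PX: "P \<subseteq> ?X \<times> ?X" by (rule oblique_trace_inj(1)[OF P])
    then have "finite P" using finite_subset by blast
    have "{p \<in> P. ca' (fst p) = (ca' \<circ> \<phi>) (snd p)} \<subseteq> {p \<in> P. ca (fst p) = cb (snd p)}"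
    proof
      fix p assume p: "p \<in> {p \<in> P. ca' (fst p) = (ca' \<circ> \<phi>) (snd p)}"
      then have "fst p \<in> ?X" "snd p \<in> ?X" using PX by auto
      moreover from this have "\<phi> (snd p) \<in> ?X" using \<phi>(1) by (auto simp: bij_betw_def)
      ultimately show "p \<in> {p \<in> P. ca (fst p) = cb (snd p)}"
        using p ca'(1)[of "fst p" "\<phi> (snd p)"] \<phi>(2)[of "snd p"] by simp
    qed
    then have "card {p \<in> P. ca' (fst p) = (ca' \<circ> \<phi>) (snd p)} \<le> card {p \<in> P. ca (fst p) = cb (snd p)}"
      using \<open>finite P\<close> by (intro card_mono) auto
    then show ?thesis using cnt[OF P] False unfolding gP by simp
  qed
  ultimately show ?thesis unfolding spread_def g_def by blast
qed

text \<open>The last stage: \<open>R\<close> is \<open>k\<close>-regular inside each column class,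
  and composing its second argument with the bijection \<open>\<phi>\<close> preserves regularity.
  Lines light for \<open>m\<close> already satisfy the bound \<open>k / 1000\<close>.\<close>

lemma spread_imp_regular_relation:
  assumes k: "10 ^ 36 \<le> k" and n: "1 \<le> n" and sp: "spread n k m e"
    and m: "k \<le> m" "m \<le> k ^ 12" and e: "0 \<le> e" "e * real k \<le> real m"
  shows "\<exists>T :: nat \<Rightarrow> nat \<Rightarrow> bool.
    (\<forall>x\<in>{1..n}. card {y \<in> {1..n}. T x y} = k) \<and> (\<forall>y\<in>{1..n}. card {x \<in> {1..n}. T x y} = k) \<and>
    (\<forall>P\<in>oblique_traces n. real (card {p \<in> P. T (fst p) (snd p)}) \<le> real k * (real (card P) / real n + 1 / 100))"
proof -
  have rk: "10 ^ 36 \<le> real k" using k by (metis numeral_power_le_of_nat_cancel_iff)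
  have rm: "real k \<le> real m" using m by simp
  have k1000: "1000000 \<le> real k" using rk by simp
  let ?X = "{1..n}"
  obtain ca cb where bal: "balanced n m ca cb" and
    cnt: "\<And>P. P \<in> oblique_traces n \<Longrightarrow> real (card {p \<in> P. ca (fst p) = cb (snd p)}) \<le>
      (if n \<le> m\<^sup>2 * card P then real m * (real (card P) / real n) + e else real k / 1000)"
    using sp unfolding spread_def by blast
  have csz: "k \<le> card {z \<in> ?X. ca z = ca x}" if "x \<in> ?X" for x
  proof -
    have "card {z \<in> ?X. ca z = ca x} \<in> {m, m + 1}" using bal that unfolding balanced_def by blast
    then show ?thesis using m by auto
  qed
  obtain R where Rca: "\<And>x z. R x z \<Longrightarrow> ca x = ca z" and R1: "\<And>x. x \<in> ?X \<Longrightarrow> card {z \<in> ?X. R x z} = k"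
    and R2: "\<And>z. z \<in> ?X \<Longrightarrow> card {x \<in> ?X. R x z} = k"
    using regular_refinement_exists[OF finite_atLeastAtMost csz] by blast
  define g where "g P = real k * (real (card P) / real n + 1 / 100)" for P :: "(nat \<times> nat) set"
  have eb: "e \<le> real m"
  proof -
    have "e * 1 \<le> e * real k" using e k1000 by (intro mult_left_mono) auto
    then show ?thesis using e by linarith
  qed
  have thr: "\<exists>t. t < m \<and> real t < g P \<and>
      ((real m * (real (card P) / real n) + e) * real k) ^ t * (800 * real m ^ 7)
        \<le> ((g P - real t) * (real m - real t)) ^ t"
    if P: "P \<in> oblique_traces n" "n \<le> m\<^sup>2 * card P" for P
  proof -
    let ?w = "real (card P) / real n"
    have w: "0 \<le> ?w" "?w \<le> 1" using oblique_trace_inj(4)[OF P(1)] n by auto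
    let ?t = "k div 1000"
    have tk: "real ?t \<le> real k / 1000" using of_nat_div_le_of_nat[of k 1000, where 'a = real] by simp
    have t1: "?t < m" using tk rm k1000 by linarith
    have t2: "real ?t < g P"
    proof -
      have "real k * (1 / 100) \<le> g P" unfolding g_def using w by (intro mult_left_mono) auto
      then show ?thesis using tk k1000 by linarith
    qed
    \<comment> \<open>In 200 blocks of \<open>k div 200000\<close> factors each block gains at least
      \<open>k / 40000000\<close>. Here \<open>power_beats_polynomial\<close> needs the fourth power
      of 40000000, about \<open>2.6 * 10 ^ 30\<close>, to be at most \<open>k\<close>.\<close>
    have y: "800 * real m ^ 7 \<le> (1 + 1 / 200) ^ ?t"
    proof -
      have "real m \<le> real k ^ 12" using m(2) by (metis of_nat_le_iff of_nat_power)
      then have "800 * real m ^ 7 \<le> 800 * (real k ^ 12) ^ 7" by (intro mult_left_mono power_mono) auto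
      also have "\<dots> = 800 * real k ^ 84" by (simp flip: power_mult)
      also have "\<dots> \<le> (real k / 40000000) ^ (4 * 50)" using rk by (intro power_beats_polynomial) auto
      also have "\<dots> = (real k / 40000000) ^ 200" by simp
      also have "\<dots> \<le> (1 + 1 / 200 * real (?t div 200)) ^ 200"
      proof -
        have "real k / 200000 - 1 \<le> real (k div 200000)"
        proof -
          have "k = 200000 * (k div 200000) + k mod 200000" "k mod 200000 < 200000" by simp_all
          then show ?thesis by linarith
        qed
        moreover have "?t div 200 = k div 200000" by (simp add: div_mult2_eq[symmetric])
        ultimately have "real k / 40000000 \<le> 1 + 1 / 200 * real (?t div 200)" by simp
        then show ?thesis by (rule power_mono) simp
      qed
      also have "\<dots> \<le> (1 + 1 / 200) ^ ?t" by (intro bernoulli_blocks) auto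
      finally show ?thesis .
    qed
    have "((real m * ?w + e) * real k) ^ ?t * (800 * real m ^ 7)
        \<le> ((g P - real ?t) * (real m - real ?t)) ^ ?t"
    proof (rule power_ratio_le[OF _ _ _ y])
      show "(real m * ?w + e) * real k * (1 + 1 / 200) \<le> (g P - real ?t) * (real m - real ?t)"
        unfolding g_def using final_line_step[OF rk w rm e _ tk] by simp
    qed (use w e in auto)
    then show ?thesis using t1 t2 by blast
  qed
  have "\<exists>\<phi>. bij_betw \<phi> ?X ?X \<and> (\<forall>y\<in>?X. ca (\<phi> y) = cb y) \<and>
    (\<forall>P\<in>oblique_traces n. n \<le> m\<^sup>2 * card P \<longrightarrow> real (card {p \<in> P. R (fst p) (\<phi> (snd p))}) \<le> g P)"
  proof (rule oblique_step[OF n _ e(1) eb bal _ _ _ thr])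
    show "2 \<le> m" using rm k1000 by linarith
    show "real (card {p \<in> P. ca (fst p) = cb (snd p)}) \<le> real m * (real (card P) / real n) + e"
      if "P \<in> oblique_traces n" "n \<le> m\<^sup>2 * card P" for P using cnt[OF that(1)] that(2) by simp
    show "card {z \<in> ?X. R x z} \<le> k" if "x \<in> ?X" for x using R1[OF that] by simp
    show "ca x = ca z" if "R x z" for x z by (rule Rca[OF that])
  qed
  then obtain \<phi> where \<phi>: "bij_betw \<phi> ?X ?X" "\<And>y. y \<in> ?X \<Longrightarrow> ca (\<phi> y) = cb y"
    and \<phi>g: "\<And>P. P \<in> oblique_traces n \<Longrightarrow> n \<le> m\<^sup>2 * card P \<Longrightarrow>
      real (card {p \<in> P. R (fst p) (\<phi> (snd p))}) \<le> g P" by blast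
  have "card {y \<in> ?X. R x (\<phi> y)} = k" if "x \<in> ?X" for x
  proof -
    have "card {y \<in> ?X. R x (\<phi> y)} = card {z \<in> ?X. R x z}"
    proof (rule bij_betw_same_card[of \<phi>])
      have "\<phi> ` {y \<in> ?X. R x (\<phi> y)} = {z \<in> \<phi> ` ?X. R x z}" by auto
      then show "bij_betw \<phi> {y \<in> ?X. R x (\<phi> y)} {z \<in> ?X. R x z}"
        using \<phi>(1) unfolding bij_betw_def by (auto intro: inj_on_subset)
    qed
    then show ?thesis using R1[OF that] by simp
  qed
  moreover have "card {x \<in> ?X. R x (\<phi> y)} = k" if "y \<in> ?X" for y
    by (rule R2) (use bij_betwE[OF \<phi>(1)] that in blast)
  moreover have "real (card {p \<in> P. R (fst p) (\<phi> (snd p))}) \<le> g P" if P: "P \<in> oblique_traces n" for P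
  proof (cases "n \<le> m\<^sup>2 * card P")
    case True then show ?thesis using \<phi>g[OF P] by simp
  next
    case False
    have PX: "P \<subseteq> ?X \<times> ?X" by (rule oblique_trace_inj(1)[OF P])
    then have "finite P" using finite_subset by blast
    have "{p \<in> P. R (fst p) (\<phi> (snd p))} \<subseteq> {p \<in> P. ca (fst p) = cb (snd p)}"
      using PX Rca \<phi>(2) by fastforce
    then have "card {p \<in> P. R (fst p) (\<phi> (snd p))} \<le> card {p \<in> P. ca (fst p) = cb (snd p)}"
      using \<open>finite P\<close> by (intro card_mono) auto
    then have "real (card {p \<in> P. R (fst p) (\<phi> (snd p))}) \<le> real k / 1000" using cnt[OF P] False by simp
    moreover have "real k * (1 / 100) \<le> g P" unfolding g_def by (intro mult_left_mono) auto
    ultimately show ?thesis by linarith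
  qed
  ultimately show ?thesis unfolding g_def by (intro exI[of _ "\<lambda>x y. R x (\<phi> y)"]) blast
qed

text \<open>All rows and columns form one matched class, so a line keeps all its points, which is
  exactly \<open>n\<close> times its weight; no line is light at this level.\<close>

lemma spread_trivial:
  assumes "1 \<le> n"
  shows "spread n k n 0"
  unfolding spread_def
proof (intro exI conjI ballI)
  show "balanced n n (\<lambda>_. 0) (\<lambda>_. 0)" unfolding balanced_def by (auto simp del: atLeastAtMost_iff)
  fix P assume P: "P \<in> oblique_traces n"
  have "n * 1 \<le> n\<^sup>2 * card P"
    using oblique_trace_inj(5)[OF P] assms by (intro mult_le_mono) (auto simp: power2_eq_square)
  then show "real (card {p \<in> P. (\<lambda>_. 0 :: nat) (fst p) = (\<lambda>_. 0) (snd p)})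
      \<le> (if n \<le> n\<^sup>2 * card P then real n * (real (card P) / real n) + 0 else real k / 1000)"
    using assms by simp
qed

text \<open>Along \<open>b j = k ^ (4 ^ j)\<close> a stage leads from
  \<open>b (Suc j) ^ 3 = b j ^ 12\<close> to \<open>b j ^ 3\<close>. The descent is entered from
  \<open>m = n\<close> at the \<open>j\<close> with
  \<open>b j ^ 12 \<le> n < b j ^ 48\<close>.\<close>

lemma spread_cube:
  assumes k: "10 ^ 36 \<le> k" and n: "k ^ 12 \<le> n"
  shows "spread n k (k ^ 3) (real k ^ 2)"
proof -
  have k2: "2 \<le> k" using k by (rule le_trans[rotated]) simp
  then have k1: "1 \<le> k" by simp
  have n1: "1 \<le> n" using n k1 one_le_power[of k 12] by linarith
  define b where "b j = k ^ (4 ^ j)" for j :: nat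
  have bk: "k \<le> b j" for j unfolding b_def using k1 by (intro self_le_power) auto
  have b4: "b (Suc j) = b j ^ 4" for j unfolding b_def by (simp add: power_mult[symmetric] mult.commute)
  have down: "spread n k (b 0 ^ 3) (real (b 0) ^ 2)" if "spread n k (b j ^ 3) (real (b j) ^ 2)" for j
    using that
  proof (induction j)
    case (Suc j)
    have b1: "1 \<le> b j" using bk[of j] k1 by linarith
    have "spread n k (b j ^ 3) (real (b j) ^ 2)"
    proof (rule spread_step[OF k bk n1 Suc.prems])
      have e: "b (Suc j) ^ 3 = b j ^ 12" unfolding b4 by (simp flip: power_mult)
      show "b j ^ 12 \<le> b (Suc j) ^ 3" "b (Suc j) ^ 3 \<le> b j ^ 48"
        unfolding e using b1 by (auto intro: power_increasing)
      show "real (b (Suc j)) ^ 2 * real (b j) ^ 4 \<le> real (b (Suc j) ^ 3)"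
        unfolding e b4 by (simp flip: power_mult power_add)
    qed simp
    then show ?case by (rule Suc.IH)
  qed simp
  obtain j where j: "b j ^ 12 \<le> n" "n < b (Suc j) ^ 12"
  proof -
    have "n < b n ^ 12"
    proof -
      have "n < 4 ^ n" by (rule less_exp[THEN less_le_trans]) (intro power_mono, auto)
      also have "4 ^ n < (2 :: nat) ^ (4 ^ n)" by (rule less_exp)
      also have "\<dots> \<le> b n" unfolding b_def using k2 by (intro power_mono) auto
      also have "\<dots> \<le> b n ^ 12" using bk[of n] k1 by (intro self_le_power) auto
      finally show ?thesis .
    qed
    moreover have "\<not> n < b 0 ^ 12" unfolding b_def using n by simp
    ultimately obtain j where "\<not> n < b j ^ 12" "n < b (Suc j) ^ 12"
      using ex_least_nat_less[of "\<lambda>j. n < b j ^ 12" n] by blast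
    then show ?thesis by (intro that[of j]) simp_all
  qed
  have "spread n k (b j ^ 3) (real (b j) ^ 2)"
  proof (rule spread_step[OF k bk n1 spread_trivial[OF n1] j(1)])
    have "b (Suc j) ^ 12 = b j ^ 48" unfolding b4 by (simp flip: power_mult)
    then show "n \<le> b j ^ 48" using j(2) by simp
  qed auto
  from down[OF this] show ?thesis unfolding b_def by simp
qed

theorem theorem1p2:
  fixes n k :: nat
  assumes "10 ^ 36 \<le> k" and "real k \<le> 0.9 * real n"
  shows "\<exists>S \<subseteq> grid n.
           (\<forall>j\<in>{1..n}. card (S \<inter> horizontal_line (real j)) = k) \<and>
           (\<forall>i\<in>{1..n}. card (S \<inter> vertical_line (real i)) = k) \<and>
           (\<forall>L\<in>grid_lines n. L \<notin> range horizontal_line \<longrightarrow> L \<notin> range vertical_line \<longrightarrow>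
              real (card (S \<inter> L)) \<le> real k * (weight n L + 0.01))"
proof -
  have k1: "1 \<le> k" using assms(1) by (rule le_trans[rotated]) simp
  have kn: "k \<le> n" using assms(2) by linarith
  then have n1: "1 \<le> n" using k1 by simp
  \<comment> \<open>If \<open>n < k ^ 12\<close>, the trivial partition with \<open>m = n\<close> is
    already in range for the last stage; otherwise the iteration brings \<open>m\<close> down to
    \<open>k ^ 3\<close> with error \<open>k ^ 2\<close>.\<close>
  have "\<exists>m e. spread n k m e \<and> k \<le> m \<and> m \<le> k ^ 12 \<and> 0 \<le> e \<and> e * real k \<le> real m"
  proof (cases "k ^ 12 \<le> n")
    case True
    show ?thesis
      using spread_cube[OF assms(1) True] k1 self_le_power[of k 3] power_increasing[of 3 12 k]
      by (intro exI[of _ "k ^ 3"] exI[of _ "real k ^ 2"]) (auto simp: eval_nat_numeral)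
  next
    case False
    then show ?thesis using spread_trivial[OF n1] kn by (intro exI[of _ n] exI[of _ 0]) auto
  qed
  then obtain T where T1: "\<And>x. x \<in> {1..n} \<Longrightarrow> card {y \<in> {1..n}. T x y} = k"
    and T2: "\<And>y. y \<in> {1..n} \<Longrightarrow> card {x \<in> {1..n}. T x y} = k"
    and T3: "\<And>P. P \<in> oblique_traces n \<Longrightarrow>
      real (card {p \<in> P. T (fst p) (snd p)}) \<le> real k * (real (card P) / real n + 1 / 100)"
    using spread_imp_regular_relation[OF assms(1) n1] by blast
  let ?r = "\<lambda>p :: nat \<times> nat. (real (fst p), real (snd p))"
  have rinj: "inj_on ?r A" for A by (auto simp: inj_on_def prod_eq_iff)
  define S where "S = ?r ` {p \<in> {1..n} \<times> {1..n}. T (fst p) (snd p)}"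
  have SL: "card (S \<inter> L) = card {p \<in> grid_trace n L. T (fst p) (snd p)}" for L
  proof -
    have "S \<inter> L = ?r ` {p \<in> grid_trace n L. T (fst p) (snd p)}" unfolding S_def grid_trace_def by auto
    then show ?thesis using card_image[OF rinj] by simp
  qed
  show ?thesis
  proof (intro exI[of _ S] conjI ballI impI)
    show "S \<subseteq> grid n" unfolding S_def grid_def by auto
    fix j assume j: "j \<in> {1..n}"
    have "{p \<in> grid_trace n (horizontal_line (real j)). T (fst p) (snd p)} = (\<lambda>x. (x, j)) ` {x \<in> {1..n}. T x j}"
      using j unfolding grid_trace_def horizontal_line_def by auto
    then show "card (S \<inter> horizontal_line (real j)) = k"
      using T2[OF j] by (simp add: SL card_image inj_on_def)
  next
    fix i assume i: "i \<in> {1..n}"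
    have "{p \<in> grid_trace n (vertical_line (real i)). T (fst p) (snd p)} = (\<lambda>y. (i, y)) ` {y \<in> {1..n}. T i y}"
      using i unfolding grid_trace_def vertical_line_def by auto
    then show "card (S \<inter> vertical_line (real i)) = k"
      using T1[OF i] by (simp add: SL card_image inj_on_def)
  next
    fix L assume L: "L \<in> grid_lines n" "L \<notin> range horizontal_line" "L \<notin> range vertical_line"
    then have "grid_trace n L \<in> oblique_traces n" unfolding oblique_traces_def by auto
    from T3[OF this] show "real (card (S \<inter> L)) \<le> real k * (weight n L + 0.01)"
      unfolding SL weight_def card_grid_Int by simp
  qed
qed

end
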